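(* Let $X$ be a Tychonoff sequentially Prohorov space and $P_r(X)$ be the space of probability Radon measures on $X$. (1) If $P_r(X)$ is $k^*$-metrizable (respectively $\mathrm{cs}^*$-metrizable), then so is the space $X$. (2) If $X$ is $k^*$-metrizable, then $P_r(X)$ is $\mathrm{cs}^*$-metrizable. (3) If $X$ is submetrizable and $k^*$-metrizable, then $P_r(X)$ is $k^*$-metrizable. (4) $X$ is an $\aleph_0$-space if and only if $P_r(X)$ is an $\aleph_0$-space.
   Context: All topological spaces are Hausdorff; "map" means continuous function. A subset is precompact if its closure is compact. A map $f:M\to X$ is subproper if there is $Z\subset M$ with $f(Z)=X$ such that $Z\cap f^{-1}(K)$ is precompact in $M$ for every precompact $K\subset X$. A space is $k^*$-metrizable if it is the image of a metrizable space under a subproper map. A section of a map $f:X\to Y$ is a (possibly discontinuous) function $s:Y\to X$ with $f\circ s=\mathrm{id}_Y$. A function $s:Y\to X$ is $\mathrm{cs}^*$-continuous if for every convergent sequence $(y_n)$ in $Y$ the sequence $(s(y_n))$ has an accumulation point in $X$ (a point each of whose neighborhoods contains $s(y_n)$ for infinitely many $n$). A space $X$ is $\mathrm{cs}^*$-metrizable if it is the image of a metrizable space $M$ under a map $\pi:M\to X$ having a $\mathrm{cs}^*$-continuous section. A space is submetrizable if it admits a continuous bijective map onto a metrizable space. An $\aleph_0$-space is a regular space with a countable $k$-network, where a $k$-network is a family $\mathcal N$ of subsets such that for every open $U$ and compact $K\subset U$ there is a finite $\mathcal F\subset\mathcal N$ with $K\subset\bigcup\mathcal F\subset U$. A Borel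 probability measure $\mu$ on $X$ is Radon if for every $\varepsilon>0$ and every Borel $B\subset X$ there is a compact $K\subset B$ with $\mu(B\setminus K)<\varepsilon$. $P_r(X)$ is the set of all Radon Borel probability measures on $X$ with the topology generated by the sub-basis of sets $\{\mu\in P_r(X):\mu(U)>a\}$, $a\in\mathbb R$, $U\subset X$ open. A family $\mathcal M\subset P_r(X)$ is uniformly tight if for every $\varepsilon>0$ there is a compact $K_\varepsilon\subset X$ with $\mu(X\setminus K_\varepsilon)<\varepsilon$ for all $\mu\in\mathcal M$. A Tychonoff space $X$ is sequentially Prohorov if each convergent sequence in $P_r(X)$ is uniformly tight. *)

theory Defs
  imports "HOL-Probability.Probability"
begin

text \<open>
  Spaces are abstract topologies and all spaces are assumed to be Hausdorff by convention; the
  predicates below that define classes of spaces therefore contain the Hausdorff axiom, whether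
  explicitly or, for \<open>submetrizable_space\<close>, by implication.
\<close>

definition tychonoff_space :: "'a topology \<Rightarrow> bool" where
  "tychonoff_space X \<longleftrightarrow> completely_regular_space X \<and> Hausdorff_space X"

definition precompactin :: "'a topology \<Rightarrow> 'a set \<Rightarrow> bool" where
  "precompactin X A \<longleftrightarrow> A \<subseteq> topspace X \<and> compactin X (X closure_of A)"

definition subproper_map :: "'m topology \<Rightarrow> 'a topology \<Rightarrow> ('m \<Rightarrow> 'a) \<Rightarrow> bool" where
  "subproper_map M X f \<longleftrightarrow> continuous_map M X f \<and>
     (\<exists>Z \<subseteq> topspace M. f ` Z = topspace X \<and>
        (\<forall>K. precompactin X K \<longrightarrow> precompactin M (Z \<inter> f -` K)))"

text \<open>
  The metrizable space in the next definition may have any underlying set, but HOL cannot quantify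
  over types. The type \<^typ>\<open>nat \<Rightarrow> 'a\<close> is large enough: one can shrink the metrizable space to
  the closure of a selection of preimages, and every point of that closure is the limit of a sequence
  indexed by points of \<open>X\<close>. The lemma \<open>k_star_metrizable_spaceI\<close> below proves that a
  metrizable space on an arbitrary type may be used instead. The same applies to
  \<open>cs_star_metrizable_space\<close> and \<open>submetrizable_space\<close>.
\<close>

definition k_star_metrizable_space :: "'a topology \<Rightarrow> bool" where
  "k_star_metrizable_space X \<longleftrightarrow> Hausdorff_space X \<and>
     (\<exists>(M :: (nat \<Rightarrow> 'a) topology) f. metrizable_space M \<and> subproper_map M X f)"

definition section_of :: "'m topology \<Rightarrow> 'a topology \<Rightarrow> ('m \<Rightarrow> 'a) \<Rightarrow> ('a \<Rightarrow> 'm) \<Rightarrow> bool" where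
  "section_of M X f s \<longleftrightarrow>
     s \<in> topspace X \<rightarrow> topspace M \<and> (\<forall>x \<in> topspace X. f (s x) = x)"

definition convergent_seq_in :: "'a topology \<Rightarrow> (nat \<Rightarrow> 'a) \<Rightarrow> bool" where
  "convergent_seq_in X y \<longleftrightarrow> range y \<subseteq> topspace X \<and> (\<exists>l. limitin X y l sequentially)"

definition accumulation_point_in :: "'a topology \<Rightarrow> (nat \<Rightarrow> 'a) \<Rightarrow> 'a \<Rightarrow> bool" where
  "accumulation_point_in X y p \<longleftrightarrow>
     p \<in> topspace X \<and> (\<forall>U. openin X U \<and> p \<in> U \<longrightarrow> infinite {n. y n \<in> U})"

definition cs_star_continuous :: "'a topology \<Rightarrow> 'm topology \<Rightarrow> ('a \<Rightarrow> 'm) \<Rightarrow> bool" where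
  "cs_star_continuous Y X s \<longleftrightarrow> s \<in> topspace Y \<rightarrow> topspace X \<and>
     (\<forall>y. convergent_seq_in Y y \<longrightarrow> (\<exists>p. accumulation_point_in X (s \<circ> y) p))"

definition cs_star_metrizable_space :: "'a topology \<Rightarrow> bool" where
  "cs_star_metrizable_space X \<longleftrightarrow> Hausdorff_space X \<and>
     (\<exists>(M :: (nat \<Rightarrow> 'a) topology) f s. metrizable_space M \<and> continuous_map M X f \<and>
        section_of M X f s \<and> cs_star_continuous X M s)"

definition submetrizable_space :: "'a topology \<Rightarrow> bool" where
  "submetrizable_space X \<longleftrightarrow>
     (\<exists>(Y :: 'a topology) f. metrizable_space Y \<and> continuous_map X Y f \<and>
        bij_betw f (topspace X) (topspace Y))"

definition k_network :: "'a topology \<Rightarrow> 'a set set \<Rightarrow> bool" where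
  "k_network X N \<longleftrightarrow> N \<subseteq> Pow (topspace X) \<and>
     (\<forall>U K. openin X U \<and> compactin X K \<and> K \<subseteq> U \<longrightarrow>
        (\<exists>F \<subseteq> N. finite F \<and> K \<subseteq> \<Union>F \<and> \<Union>F \<subseteq> U))"

definition aleph0_space :: "'a topology \<Rightarrow> bool" where
  "aleph0_space X \<longleftrightarrow> Hausdorff_space X \<and> regular_space X \<and> (\<exists>N. countable N \<and> k_network X N)"

definition borel_sigma :: "'a topology \<Rightarrow> 'a measure" where
  "borel_sigma X = sigma (topspace X) {U. openin X U}"

text \<open>Compact sets are Borel because the spaces are Hausdorff, so \<open>B - K\<close> is measurable below.\<close>

definition radon_probs :: "'a topology \<Rightarrow> 'a measure set" where
  "radon_probs X = {\<mu>. prob_space \<mu> \<and> sets \<mu> = sets (borel_sigma X) \<and>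
     (\<forall>\<epsilon>>0. \<forall>B \<in> sets \<mu>. \<exists>K \<subseteq> B. compactin X K \<and> measure \<mu> (B - K) < \<epsilon>)}"

definition radon_prob_space :: "'a topology \<Rightarrow> 'a measure topology" where
  "radon_prob_space X = topology_generated_by
     {{\<mu> \<in> radon_probs X. measure \<mu> U > a} | a U. openin X U}"

definition uniformly_tight :: "'a topology \<Rightarrow> 'a measure set \<Rightarrow> bool" where
  "uniformly_tight X \<M> \<longleftrightarrow> \<M> \<subseteq> radon_probs X \<and>
     (\<forall>\<epsilon>>0. \<exists>K. compactin X K \<and> (\<forall>\<mu> \<in> \<M>. measure \<mu> (topspace X - K) < \<epsilon>))"

definition sequentially_prohorov :: "'a topology \<Rightarrow> bool" where
  "sequentially_prohorov X \<longleftrightarrow> tychonoff_space X \<and>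
     (\<forall>\<mu>. convergent_seq_in (radon_prob_space X) \<mu> \<longrightarrow> uniformly_tight X (range \<mu>))"

lemma topspace_radon_prob_space: "topspace (radon_prob_space X) = radon_probs X"
proof -
  have "\<exists>S \<in> {{\<mu> \<in> radon_probs X. measure \<mu> U > a} | a U. openin X U}. \<mu> \<in> S"
    if "\<mu> \<in> radon_probs X" for \<mu>
  proof (intro bexI[of _ "{\<mu> \<in> radon_probs X. measure \<mu> {} > -1}"])
    show "{\<mu> \<in> radon_probs X. measure \<mu> {} > -1}
        \<in> {{\<mu> \<in> radon_probs X. measure \<mu> U > a} | a U. openin X U}"
      using openin_empty[of X] by blast
  qed (use that in auto)
  then show ?thesis
    unfolding radon_prob_space_def topology_generated_by_topspace by blast
qed

lemma space_radon_probs: "\<mu> \<in> radon_probs X \<Longrightarrow> space \<mu> = topspace X"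
  using sets_eq_imp_space_eq[of \<mu> "borel_sigma X"]
  by (auto simp: radon_probs_def borel_sigma_def space_measure_of_conv)

subsection \<open>Independence of the chosen carrier types\<close>

lemma homeomorphic_copy:
  fixes e :: "'m \<Rightarrow> 'n"
  assumes inj: "inj_on e (topspace M)"
  obtains N where "homeomorphic_map M N e"
proof -
  define g where "g = inv_into (topspace M) e"
  define N where "N = pullback_topology (e ` topspace M) g M"
  have ge: "g (e x) = x" if "x \<in> topspace M" for x
    using inj that by (simp add: g_def)
  have top: "topspace N = e ` topspace M"
    by (auto simp: N_def topspace_pullback_topology ge)
  have op: "openin N V \<longleftrightarrow> (\<exists>U. openin M U \<and> V = e ` U)" for V
  proof -
    have "g -` U \<inter> e ` topspace M = e ` U" if "openin M U" for U
      using openin_subset[OF that] by (force simp: ge)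
    then show ?thesis
      unfolding N_def openin_pullback_topology by metis
  qed
  have "continuous_map N M g"
    unfolding continuous_map_def
  proof (intro conjI allI impI)
    show "g \<in> topspace N \<rightarrow> topspace M"
      by (auto simp: top ge)
    fix U assume U: "openin M U"
    have "{x \<in> topspace N. g x \<in> U} = e ` U"
      using openin_subset[OF U] by (force simp: top ge)
    then show "openin N {x \<in> topspace N. g x \<in> U}"
      using U op by blast
  qed
  moreover have "continuous_map M N e"
    unfolding continuous_map_def
  proof (intro conjI allI impI)
    show "e \<in> topspace M \<rightarrow> topspace N"
      by (auto simp: top)
    fix V assume "openin N V"
    then obtain U where U: "openin M U" "V = e ` U"
      using op by blast
    have "{x \<in> topspace M. e x \<in> V} = U"
      using openin_subset[OF U(1)] inj by (auto simp: U(2) dest: inj_onD)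
    then show "openin M {x \<in> topspace M. e x \<in> V}"
      using U by simp
  qed
  ultimately have "homeomorphic_maps M N e g"
    by (auto simp: homeomorphic_maps_def ge top)
  then show thesis
    using that homeomorphic_map_maps by blast
qed

lemma metrizable_closure_copy:
  fixes M :: "'m topology" and s :: "'a \<Rightarrow> 'm"
  assumes M: "metrizable_space M" and s: "s ` Y \<subseteq> topspace M"
  obtains N :: "(nat \<Rightarrow> 'a) topology" and e g where
    "metrizable_space N" "homeomorphic_maps (subtopology M (M closure_of (s ` Y))) N e g"
proof -
  let ?C = "M closure_of (s ` Y)"
  have H: "Hausdorff_space M"
    using M by (rule metrizable_imp_Hausdorff_space)
  have ex: "\<exists>\<sigma>. limitin M (s \<circ> \<sigma>) p sequentially" if "p \<in> ?C" for p
  proof -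
    obtain D d where "Metric_space D d" and Md: "M = Metric_space.mtopology D d"
      using M unfolding metrizable_space_def by blast
    then interpret Metric_space D d by simp
    obtain \<tau> where r: "range \<tau> \<subseteq> s ` Y" and \<tau>: "limitin M \<tau> p sequentially"
      using \<open>p \<in> ?C\<close> unfolding Md closure_of_sequentially by blast
    from r have "\<forall>n. \<exists>y. s y = \<tau> n" by (metis image_iff range_subsetD)
    then obtain \<sigma> where "\<forall>n. s (\<sigma> n) = \<tau> n" by metis
    then have "s \<circ> \<sigma> = \<tau>" by auto
    then show ?thesis using \<tau> by blast
  qed
  define e where "e p = (SOME \<sigma>. limitin M (s \<circ> \<sigma>) p sequentially)" for p
  have e: "limitin M (s \<circ> e p) p sequentially" if "p \<in> ?C" for p
    unfolding e_def using ex[OF that] by (rule someI_ex)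
  have "inj_on e (topspace (subtopology M ?C))"
  proof (rule inj_onI)
    fix p q
    assume "p \<in> topspace (subtopology M ?C)" "q \<in> topspace (subtopology M ?C)" "e p = e q"
    then have "limitin M (s \<circ> e p) p sequentially" "limitin M (s \<circ> e p) q sequentially"
      using e[of p] e[of q] by simp_all
    then show "p = q"
      using limitin_Hausdorff_unique[OF _ _ trivial_limit_sequentially H] by blast
  qed
  then obtain N where N: "homeomorphic_map (subtopology M ?C) N e"
    by (rule homeomorphic_copy)
  then obtain g where "homeomorphic_maps (subtopology M ?C) N e g"
    using homeomorphic_map_maps by blast
  moreover have "metrizable_space N"
    using N M metrizable_space_subtopology homeomorphic_metrizable_space
      homeomorphic_map_imp_homeomorphic_space by blast
  ultimately show thesis using that by blast
qed

lemma k_star_metrizable_spaceI: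
  fixes M :: "'m topology" and X :: "'a topology"
  assumes X: "Hausdorff_space X" and M: "metrizable_space M" and f: "subproper_map M X f"
  shows "k_star_metrizable_space X"
proof -
  obtain Z where Z: "Z \<subseteq> topspace M" "f ` Z = topspace X"
    and pre: "\<And>K. precompactin X K \<Longrightarrow> precompactin M (Z \<inter> f -` K)"
    and cf: "continuous_map M X f"
    using f unfolding subproper_map_def by blast
  have "\<forall>x \<in> topspace X. \<exists>z. z \<in> Z \<and> f z = x"
    by (metis Z(2) imageE)
  then obtain s where s: "\<And>x. x \<in> topspace X \<Longrightarrow> s x \<in> Z \<and> f (s x) = x"
    by metis
  define A where "A = s ` topspace X"
  define C where "C = M closure_of A"
  have AZ: "A \<subseteq> Z" and AM: "A \<subseteq> topspace M" and AC: "A \<subseteq> C"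
    using s Z(1) closure_of_subset[of A M] by (auto simp: A_def C_def)
  have CM: "C \<subseteq> topspace M"
    by (simp add: C_def closure_of_subset_topspace)
  obtain N :: "(nat \<Rightarrow> 'a) topology" and e g where N: "metrizable_space N"
    and h: "homeomorphic_maps (subtopology M C) N e g"
    using metrizable_closure_copy[OF M, of s "topspace X"] AM unfolding A_def C_def by blast
  have hm: "homeomorphic_map (subtopology M C) N e"
    using h homeomorphic_map_maps by blast
  have ge: "g (e p) = p" if "p \<in> C" for p
    using h that CM by (auto simp: homeomorphic_maps_def)
  have eN: "e ` C = topspace N"
    using homeomorphic_imp_surjective_map[OF hm] CM by (simp add: Int_absorb1)
  have "subproper_map N X (f \<circ> g)"
    unfolding subproper_map_def
  proof (intro conjI exI[of _ "e ` A"] allI impI)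
    show "continuous_map N X (f \<circ> g)"
      using h cf by (meson continuous_map_compose continuous_map_into_fulltopology
          homeomorphic_maps_def)
    show "e ` A \<subseteq> topspace N"
      using AC eN by blast
    show "(f \<circ> g) ` e ` A = topspace X"
    proof -
      have "(f \<circ> g) ` e ` A = f ` A"
        unfolding image_comp using ge AC by (intro image_cong) auto
      also have "\<dots> = topspace X"
        using s by (force simp: A_def)
      finally show ?thesis .
    qed
    fix K assume "precompactin X K"
    then have K: "compactin M (M closure_of (Z \<inter> f -` K))"
      using pre precompactin_def by blast
    let ?B = "A \<inter> f -` K"
    have B: "M closure_of ?B \<subseteq> M closure_of (Z \<inter> f -` K)"
      using AZ by (intro closure_of_mono) auto
    have BC: "M closure_of ?B \<subseteq> C"
      unfolding C_def by (intro closure_of_mono) auto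
    have "compactin M (M closure_of ?B)"
      using closed_compactin[OF K B] by simp
    then have c: "compactin (subtopology M C) (M closure_of ?B)"
      using BC by (simp add: compactin_subtopology)
    have eq: "e ` A \<inter> (f \<circ> g) -` K = e ` ?B"
      using ge AC by (auto simp: subset_iff)
    have "subtopology M C closure_of ?B = M closure_of ?B"
    proof -
      have "C \<inter> ?B = ?B" using AC by blast
      then show ?thesis
        using BC by (simp only: closure_of_subtopology Int_absorb1)
    qed
    moreover have "?B \<subseteq> topspace (subtopology M C)"
      using AC AM by auto
    ultimately have "N closure_of (e ` ?B) = e ` (M closure_of ?B)"
      using homeomorphic_map_closure_of[OF hm] by metis
    moreover have "compactin N (e ` (M closure_of ?B))"
      using homeomorphic_map_compactness_eq[OF hm] c by blast
    ultimately show "precompactin N (e ` A \<inter> (f \<circ> g) -` K)"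
      using AC unfolding eq precompactin_def eN[symmetric] by auto
  qed
  then show ?thesis
    using X N unfolding k_star_metrizable_space_def by blast
qed

lemma cs_star_metrizable_spaceI:
  fixes M :: "'m topology" and X :: "'a topology"
  assumes X: "Hausdorff_space X" and M: "metrizable_space M" and cf: "continuous_map M X f"
    and s: "section_of M X f s" and cs: "cs_star_continuous X M s"
  shows "cs_star_metrizable_space X"
proof -
  define A where "A = s ` topspace X"
  define C where "C = M closure_of A"
  have sM: "s \<in> topspace X \<rightarrow> topspace M" and fs: "\<And>x. x \<in> topspace X \<Longrightarrow> f (s x) = x"
    using s by (auto simp: section_of_def)
  have AM: "A \<subseteq> topspace M" and AC: "A \<subseteq> C"
    using sM closure_of_subset[of A M] by (auto simp: A_def C_def)
  have CM: "C \<subseteq> topspace M"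
    by (simp add: C_def closure_of_subset_topspace)
  obtain N :: "(nat \<Rightarrow> 'a) topology" and e g where N: "metrizable_space N"
    and h: "homeomorphic_maps (subtopology M C) N e g"
    using metrizable_closure_copy[OF M, of s "topspace X"] AM unfolding A_def C_def by blast
  have hm: "homeomorphic_map (subtopology M C) N e"
    using h homeomorphic_map_maps by blast
  have ce: "continuous_map (subtopology M C) N e"
    using h homeomorphic_maps_def by blast
  have ge: "g (e p) = p" if "p \<in> C" for p
    using h that CM by (auto simp: homeomorphic_maps_def)
  have eN: "e ` C = topspace N"
    using homeomorphic_imp_surjective_map[OF hm] CM by (simp add: Int_absorb1)
  have es: "e \<circ> s \<in> topspace X \<rightarrow> topspace N"
    using AC unfolding A_def eN[symmetric] by auto
  have "continuous_map N X (f \<circ> g)"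
    using h cf by (meson continuous_map_compose continuous_map_into_fulltopology
        homeomorphic_maps_def)
  moreover have "section_of N X (f \<circ> g) (e \<circ> s)"
    using es fs ge AC by (auto simp: section_of_def A_def)
  moreover have "cs_star_continuous X N (e \<circ> s)"
    unfolding cs_star_continuous_def
  proof (intro conjI allI impI)
    show "e \<circ> s \<in> topspace X \<rightarrow> topspace N" by (rule es)
    fix y assume y: "convergent_seq_in X y"
    then obtain p where p: "accumulation_point_in M (s \<circ> y) p"
      using cs unfolding cs_star_continuous_def by blast
    have yX: "s (y n) \<in> A" for n
      using y by (auto simp: convergent_seq_in_def A_def)
    have pC: "p \<in> C"
      unfolding C_def in_closure_of
    proof (intro conjI allI impI)
      show "p \<in> topspace M" using p by (simp add: accumulation_point_in_def)
      fix T assume "p \<in> T \<and> openin M T"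
      then have "infinite {n. (s \<circ> y) n \<in> T}"
        using p by (auto simp: accumulation_point_in_def)
      then have "{n. (s \<circ> y) n \<in> T} \<noteq> {}"
        using finite.emptyI by metis
      then obtain n where "(s \<circ> y) n \<in> T"
        by blast
      then show "\<exists>q. q \<in> A \<and> q \<in> T" using yX by auto
    qed
    have "accumulation_point_in N (e \<circ> s \<circ> y) (e p)"
      unfolding accumulation_point_in_def
    proof (intro conjI allI impI)
      show "e p \<in> topspace N" using pC eN by blast
      fix U assume U: "openin N U \<and> e p \<in> U"
      have "openin (subtopology M C) {x \<in> topspace (subtopology M C). e x \<in> U}"
        using ce U by (simp add: continuous_map_def)
      then obtain T where T: "openin M T" "{x \<in> topspace (subtopology M C). e x \<in> U} = T \<inter> C"
        unfolding openin_subtopology by blast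
      have "p \<in> T" using T(2) pC CM U by auto
      then have inf: "infinite {n. (s \<circ> y) n \<in> T}"
        using p T(1) by (simp add: accumulation_point_in_def)
      have "{n. (s \<circ> y) n \<in> T} \<subseteq> {n. (e \<circ> s \<circ> y) n \<in> U}"
        using T(2) yX AC by auto
      then show "infinite {n. (e \<circ> s \<circ> y) n \<in> U}"
        using inf infinite_super by blast
    qed
    then show "\<exists>p. accumulation_point_in N (e \<circ> s \<circ> y) p" by blast
  qed
  ultimately show ?thesis
    using X N unfolding cs_star_metrizable_space_def by blast
qed

lemma submetrizable_spaceI:
  fixes Y :: "'b topology" and X :: "'a topology"
  assumes Y: "metrizable_space Y" and f: "continuous_map X Y f"
    and bij: "bij_betw f (topspace X) (topspace Y)"
  shows "submetrizable_space X"
proof -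
  define g where "g = inv_into (topspace X) f"
  have g: "bij_betw g (topspace Y) (topspace X)"
    unfolding g_def using bij by (rule bij_betw_inv_into)
  then obtain N where N: "homeomorphic_map Y N g"
    using homeomorphic_copy[of g Y] bij_betw_imp_inj_on by blast
  have "continuous_map X N (g \<circ> f)"
    using f N continuous_map_compose homeomorphic_imp_continuous_map by blast
  moreover have "bij_betw (g \<circ> f) (topspace X) (topspace N)"
    using bij_betw_trans[OF bij g] homeomorphic_imp_surjective_map[OF N] g
    by (simp add: bij_betw_imp_surj_on)
  moreover have "metrizable_space N"
    using Y N homeomorphic_map_imp_homeomorphic_space homeomorphic_metrizable_space by blast
  ultimately show ?thesis
    unfolding submetrizable_space_def by blast
qed

end

theory Submission
  imports Defs
begin

text \<open>
  Write \<open>P\<close> for the space of Radon probability measures on \<open>X\<close>. Point masses embed \<open>X\<close> into \<open>P\<close>,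
  and all three classes of spaces pass to subspaces. This gives every implication from \<open>P\<close> to
  \<open>X\<close>: \<open>embedding_map_dirac\<close> with \<open>k_star_metrizable_embedding\<close>, \<open>cs_star_metrizable_embedding\<close>
  and \<open>aleph0_embedding\<close>.

  For the converse, let \<open>f\<close> map a metric space \<open>M\<close> onto \<open>X\<close>, with a section \<open>s\<close> that sends every
  compact set into a compact set. The natural candidate for a metrizable space over \<open>P\<close> is the
  space of Radon measures on \<open>M\<close>, but lifting a measure from \<open>X\<close> to \<open>M\<close> requires a measurable
  selection or an extension theorem, since \<open>s\<close> need not be measurable. The upper integral avoids
  this: a measure \<open>\<mu>\<close> is lifted to the functional that sends a 1-Lipschitz function \<open>\<phi> : M \<rightarrow>
  [0,1]\<close> to the upper integral of \<open>\<phi> \<circ> s\<close>. It need not be linear, but it is monotone, changes by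
  at most \<open>\<epsilon>\<close> when \<open>\<phi>\<close> changes by at most \<open>\<epsilon>\<close>, and a set of measure \<open>\<epsilon>\<close> contributes at most \<open>\<epsilon>\<close>
  to it, which is all the argument uses. The functionals carry the supremum metric. Those which
  determine a measure on \<open>X\<close>, in the sense that \<open>\<mu> U\<close> is the supremum of \<open>\<Phi> \<phi> / r\<close> over the
  functions \<open>\<phi> \<le> r\<close> that vanish outside the preimage of \<open>U\<close>, form a metric space over \<open>P\<close>, and
  the projection to \<open>P\<close> is continuous because the supremum makes \<open>\<Phi> \<mapsto> \<mu> U\<close> lower semicontinuous.

  A convergent sequence of measures is uniformly tight, so up to \<open>\<epsilon>\<close> only a compact subset of \<open>M\<close>
  matters. On it the 1-Lipschitz functions have finite \<open>\<epsilon>\<close>-nets, hence the lifted functionals are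
  totally bounded and have a convergent subsequence (\<open>tight_functionals_convergent_subsequence\<close>).
  Its limit again represents the limit measure (\<open>upper_subsequence\<close>), so the lift is a
  \<open>cs\<^sup>*\<close>-continuous section. If compact subsets of \<open>P\<close> are sequentially compact, then the lift of
  a compact set is precompact as well, and \<open>P\<close> is \<open>k\<^sup>*\<close>-metrizable. Sequential compactness
  follows from any continuous injection \<open>g\<close> of \<open>X\<close> into a metric space, because integrating the
  functions \<open>\<phi> \<circ> g\<close> with \<open>\<phi>\<close> 1-Lipschitz is then a continuous injection of \<open>P\<close> into a metric
  space (\<open>radon_seq_compact\<close>).

  If \<open>X\<close> is an \<open>\<aleph>\<^sub>0\<close>-space, countably many real functions separate its points, so compact subsets
  of \<open>P\<close> are sequentially compact. In such a space a countable family that contains, inside every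
  neighbourhood of a limit, a member with infinitely many terms of the sequence is already a
  \<open>k\<close>-network (\<open>k_networkI_convergent_seq\<close>). Such a family is given by the finite intersections
  of the sets of measures whose inner measure of \<open>A\<close> exceeds \<open>q\<close>, for finite unions \<open>A\<close> of
  network elements and rational \<open>q\<close>; here the tightness of convergent sequences provides the
  compact sets to be covered by \<open>A\<close>.
\<close>

section \<open>Radon probability measures and their topology\<close>

lemma radon_probsD:
  assumes "\<mu> \<in> radon_probs X"
  shows "prob_space \<mu>" "sets \<mu> = sets (borel_sigma X)" "space \<mu> = topspace X"
  using assms space_radon_probs by (auto simp: radon_probs_def)

lemma open_in_sets_radon:
  assumes "\<mu> \<in> radon_probs X" "openin X U"
  shows "U \<in> sets \<mu>"
proof -
  have "{U. openin X U} \<subseteq> Pow (topspace X)"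
    using openin_subset by auto
  then show ?thesis
    using assms by (auto simp: radon_probsD borel_sigma_def sets_measure_of)
qed

lemma closed_in_sets_radon:
  assumes "\<mu> \<in> radon_probs X" "closedin X A"
  shows "A \<in> sets \<mu>"
proof -
  have "topspace X - (topspace X - A) = A"
    using closedin_subset[OF assms(2)] by auto
  then show ?thesis
    using sets.compl_sets[OF open_in_sets_radon[OF assms(1), of "topspace X - A"]] assms
    by (simp add: radon_probsD closedin_def)
qed

lemma compact_in_sets_radon:
  assumes "\<mu> \<in> radon_probs X" "Hausdorff_space X" "compactin X K"
  shows "K \<in> sets \<mu>"
  using assms closed_in_sets_radon compactin_imp_closedin by metis

lemma measure_compl_radon:
  assumes "\<mu> \<in> radon_probs X" "A \<in> sets \<mu>"
  shows "measure \<mu> (topspace X - A) = 1 - measure \<mu> A"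
  using prob_space.prob_compl[OF radon_probsD(1)[OF assms(1)] assms(2)] radon_probsD(3)[OF assms(1)]
  by simp

lemma measure_mono_radon:
  assumes "\<mu> \<in> radon_probs X" "B \<in> sets \<mu>" "A \<subseteq> B"
  shows "measure \<mu> A \<le> measure \<mu> B"
proof (cases "A \<in> sets \<mu>")
  case True
  interpret prob_space \<mu> using radon_probsD(1)[OF assms(1)] .
  show ?thesis using assms True finite_measure_mono by auto
next
  case False
  then show ?thesis by (simp add: measure_notin_sets)
qed

lemma radon_inner_compact:
  assumes \<mu>: "\<mu> \<in> radon_probs X" and H: "Hausdorff_space X" and B: "B \<in> sets \<mu>"
    and a: "a < measure \<mu> B"
  obtains K where "compactin X K" "K \<subseteq> B" "a < measure \<mu> K"
proof -
  interpret prob_space \<mu> using radon_probsD(1)[OF \<mu>] .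
  obtain K where K: "K \<subseteq> B" "compactin X K" "measure \<mu> (B - K) < measure \<mu> B - a"
    using \<mu> B a unfolding radon_probs_def by (smt (verit) mem_Collect_eq)
  moreover have "measure \<mu> (B - K) = measure \<mu> B - measure \<mu> K"
    using finite_measure_Diff[OF B compact_in_sets_radon[OF \<mu> H K(2)] K(1)] .
  ultimately show thesis using that by auto
qed

text \<open>
  A compact set of almost full measure in \<open>U\<close> is separated from the complement of \<open>U\<close> by
  regularity. The closed set in between is what survives limits of measures from above, the open
  one from below.
\<close>

lemma radon_inner_open:
  assumes \<mu>: "\<mu> \<in> radon_probs X" and H: "Hausdorff_space X" and R: "regular_space X"
    and U: "openin X U" and a: "a < measure \<mu> U"
  obtains V C where "openin X V" "closedin X C" "V \<subseteq> C" "C \<subseteq> U" "a < measure \<mu> V"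
proof -
  obtain K where K: "compactin X K" "K \<subseteq> U" "a < measure \<mu> K"
    using radon_inner_compact[OF \<mu> H open_in_sets_radon[OF \<mu> U] a] by blast
  have "closedin X (topspace X - U)" "disjnt K (topspace X - U)"
    using U K by (auto simp: disjnt_iff)
  then obtain V W where VW: "openin X V" "openin X W" "K \<subseteq> V" "topspace X - U \<subseteq> W" "disjnt V W"
    using regular_space_compact_closed_separation[OF R K(1)] by metis
  have "V \<subseteq> topspace X - W"
    using VW openin_subset[OF VW(1)] by (auto simp: disjnt_iff)
  moreover have "a < measure \<mu> V"
    using measure_mono_radon[OF \<mu> open_in_sets_radon[OF \<mu> VW(1)] VW(3)] K(3) by simp
  ultimately show thesis
    using that[of V "topspace X - W"] VW by auto
qed

lemma openin_measure_greater:
  assumes "openin X U"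
  shows "openin (radon_prob_space X) {\<mu> \<in> radon_probs X. a < measure \<mu> U}"
  unfolding radon_prob_space_def using assms by (intro topology_generated_by_Basis) blast

text \<open>
  The masses of all measures are equal to one, so that the defining lower bounds on open sets are
  upper bounds on closed sets.
\<close>

lemma openin_measure_less:
  assumes "closedin X A"
  shows "openin (radon_prob_space X) {\<mu> \<in> radon_probs X. measure \<mu> A < a}"
proof -
  have "{\<mu> \<in> radon_probs X. measure \<mu> A < a}
      = {\<mu> \<in> radon_probs X. 1 - a < measure \<mu> (topspace X - A)}"
    using measure_compl_radon closed_in_sets_radon assms by fastforce
  then show ?thesis
    using openin_measure_greater[of X "topspace X - A" "1 - a"] assms by (simp add: closedin_def)
qed

lemma limitin_measure_greater:
  assumes lim: "limitin (radon_prob_space X) \<mu> \<nu> F" and U: "openin X U" and a: "a < measure \<nu> U"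
  shows "\<forall>\<^sub>F n in F. a < measure (\<mu> n) U"
proof -
  have "\<nu> \<in> radon_probs X"
    using limitin_topspace[OF lim] by (simp add: topspace_radon_prob_space)
  then have "\<forall>\<^sub>F n in F. \<mu> n \<in> {\<mu> \<in> radon_probs X. a < measure \<mu> U}"
    using lim openin_measure_greater[OF U, of a] a unfolding limitin_def by blast
  then show ?thesis by (rule eventually_mono) auto
qed

lemma limitin_measure_less:
  assumes lim: "limitin (radon_prob_space X) \<mu> \<nu> F" and A: "closedin X A" and a: "measure \<nu> A < a"
  shows "\<forall>\<^sub>F n in F. measure (\<mu> n) A < a"
proof -
  have "\<nu> \<in> radon_probs X"
    using limitin_topspace[OF lim] by (simp add: topspace_radon_prob_space)
  then have "\<forall>\<^sub>F n in F. \<mu> n \<in> {\<mu> \<in> radon_probs X. measure \<mu> A < a}"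
    using lim openin_measure_less[OF A, of a] a unfolding limitin_def by blast
  then show ?thesis by (rule eventually_mono) auto
qed

lemma radon_eqI_open:
  assumes \<mu>: "\<mu> \<in> radon_probs X" and \<nu>: "\<nu> \<in> radon_probs X"
    and eq: "\<And>U. openin X U \<Longrightarrow> measure \<mu> U = measure \<nu> U"
  shows "\<mu> = \<nu>"
proof (rule measure_eqI_generator_eq)
  interpret \<mu>: prob_space \<mu> using radon_probsD(1)[OF \<mu>] .
  interpret \<nu>: prob_space \<nu> using radon_probsD(1)[OF \<nu>] .
  let ?E = "{U. openin X U}"
  have E: "?E \<subseteq> Pow (topspace X)"
    using openin_subset by auto
  show "Int_stable ?E" by (auto simp: Int_stable_def)
  show "?E \<subseteq> Pow (topspace X)" by (rule E)
  show "sets \<mu> = sigma_sets (topspace X) ?E" "sets \<nu> = sigma_sets (topspace X) ?E"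
    using E by (auto simp: radon_probsD[OF \<mu>] radon_probsD[OF \<nu>] borel_sigma_def sets_measure_of)
  show "emeasure \<mu> U = emeasure \<nu> U" if "U \<in> ?E" for U
    using eq that by (simp add: \<mu>.emeasure_eq_measure \<nu>.emeasure_eq_measure)
  show "range (\<lambda>_::nat. topspace X) \<subseteq> ?E" "(\<Union>i::nat. topspace X) = topspace X" by auto
  show "emeasure \<mu> (topspace X) \<noteq> \<infinity>" for i :: nat by simp
qed

text \<open>
  Inner regularity computes the measure of an open set from compact sets, and the open sets form
  an intersection-stable generator.
\<close>

lemma radon_eqI_compact:
  assumes \<mu>: "\<mu> \<in> radon_probs X" and \<nu>: "\<nu> \<in> radon_probs X" and H: "Hausdorff_space X"
    and eq: "\<And>K. compactin X K \<Longrightarrow> measure \<mu> K = measure \<nu> K"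
  shows "\<mu> = \<nu>"
proof -
  have le: "measure \<mu> U \<le> measure \<nu> U"
    if m: "\<mu> \<in> radon_probs X" and n: "\<nu> \<in> radon_probs X" and U: "openin X U"
      and eq: "\<And>K. compactin X K \<Longrightarrow> measure \<mu> K = measure \<nu> K" for \<mu> \<nu> U
  proof (rule ccontr)
    assume "\<not> ?thesis"
    then obtain K where "compactin X K" "K \<subseteq> U" "measure \<nu> U < measure \<mu> K"
      using radon_inner_compact[OF m H open_in_sets_radon[OF m U], of "measure \<nu> U"]
      by auto
    then show False
      using measure_mono_radon[OF n open_in_sets_radon[OF n U], of K] eq by auto
  qed
  show ?thesis
  proof (rule radon_eqI_open[OF \<mu> \<nu>])
    fix U assume U: "openin X U"
    show "measure \<mu> U = measure \<nu> U"
      using le[OF \<mu> \<nu> U] le[OF \<nu> \<mu> U] eq by (simp add: antisym)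
  qed
qed

text \<open>
  Shrinking \<open>U\<close> to an open \<open>V\<close> inside a closed \<open>C \<subseteq> U\<close> puts the closed set of measures with \<open>\<mu> C
  \<ge> b\<close> between the open sets given by \<open>\<mu> V > b\<close> and \<open>\<mu> U > a\<close>.
\<close>

lemma regular_radon_prob_space:
  assumes H: "Hausdorff_space X" and R: "regular_space X"
  shows "regular_space (radon_prob_space X)"
proof -
  let ?P = "radon_prob_space X"
  have base: "\<exists>V C. openin ?P V \<and> closedin ?P C \<and> \<mu> \<in> V \<and> V \<subseteq> C \<and> C \<subseteq> W"
    if "generate_topology_on {{\<mu> \<in> radon_probs X. measure \<mu> U > a} | a U. openin X U} W" "\<mu> \<in> W"
    for W \<mu>
    using that
  proof (induction arbitrary: \<mu>)
    case (Int W W')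
    from Int.IH(1)[of \<mu>] Int.prems obtain V C where
      "openin ?P V" "closedin ?P C" "\<mu> \<in> V" "V \<subseteq> C" "C \<subseteq> W"
      by blast
    moreover from Int.IH(2)[of \<mu>] Int.prems obtain V' C' where
      "openin ?P V'" "closedin ?P C'" "\<mu> \<in> V'" "V' \<subseteq> C'" "C' \<subseteq> W'"
      by blast
    ultimately show ?case
      by (intro exI[of _ "V \<inter> V'"] exI[of _ "C \<inter> C'"]) auto
  next
    case (UN \<W>)
    then obtain W where W: "W \<in> \<W>" "\<mu> \<in> W" by blast
    then obtain V C where "openin ?P V" "closedin ?P C" "\<mu> \<in> V" "V \<subseteq> C" "C \<subseteq> W"
      using UN.IH[OF W] by blast
    then show ?case using W(1) by (intro exI[of _ V] exI[of _ C]) auto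
  next
    case (Basis W)
    then obtain a U where W: "W = {\<mu> \<in> radon_probs X. a < measure \<mu> U}" and U: "openin X U"
      using Basis.hyps by blast
    have \<mu>: "\<mu> \<in> radon_probs X" "a < measure \<mu> U" using Basis.prems unfolding W by simp_all
    obtain b where b: "a < b" "b < measure \<mu> U" using \<mu>(2) dense by blast
    obtain V C where VC: "openin X V" "closedin X C" "V \<subseteq> C" "C \<subseteq> U" "b < measure \<mu> V"
      using radon_inner_open[OF \<mu>(1) H R U b(2)] by blast
    let ?O = "{\<mu> \<in> radon_probs X. b < measure \<mu> V}"
    let ?C = "{\<mu> \<in> radon_probs X. b \<le> measure \<mu> C}"
    have "?C = topspace ?P - {\<mu> \<in> radon_probs X. measure \<mu> C < b}"
      by (auto simp: topspace_radon_prob_space)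
    then have "closedin ?P ?C"
      using openin_measure_less[OF VC(2), of b] by auto
    moreover have "?O \<subseteq> ?C"
    proof safe
      fix \<kappa> assume "\<kappa> \<in> radon_probs X" "b < measure \<kappa> V"
      then show "b \<le> measure \<kappa> C"
        using measure_mono_radon[of \<kappa> X C V] closed_in_sets_radon VC by fastforce
    qed
    moreover have "?C \<subseteq> W"
      unfolding W
    proof safe
      fix \<kappa> assume "\<kappa> \<in> radon_probs X" "b \<le> measure \<kappa> C"
      then show "a < measure \<kappa> U"
        using measure_mono_radon[of \<kappa> X U C] open_in_sets_radon[OF _ U] VC(4) b(1) by fastforce
    qed
    ultimately have "openin ?P ?O \<and> closedin ?P ?C \<and> \<mu> \<in> ?O \<and> ?O \<subseteq> ?C \<and> ?C \<subseteq> W"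
      using openin_measure_greater[OF VC(1), of b] VC(5) \<mu>(1) by simp
    then show ?case by (intro exI)
  next
    case Empty
    then show ?case by simp
  qed
  show ?thesis
    unfolding neighbourhood_base_of_closedin[symmetric] neighbourhood_base_of
  proof (intro allI impI)
    fix W \<mu> assume W: "openin ?P W \<and> \<mu> \<in> W"
    then have "generate_topology_on {{\<mu> \<in> radon_probs X. measure \<mu> U > a} | a U. openin X U} W"
      by (simp add: radon_prob_space_def openin_topology_generated_by_iff)
    from base[OF this] W
    show "\<exists>V C. openin ?P V \<and> closedin ?P C \<and> \<mu> \<in> V \<and> V \<subseteq> C \<and> C \<subseteq> W"
      by simp
  qed
qed

lemma Hausdorff_radon_prob_space:
  assumes H: "Hausdorff_space X" and R: "regular_space X"
  shows "Hausdorff_space (radon_prob_space X)"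
proof (rule regular_t0_imp_Hausdorff_space[OF regular_radon_prob_space[OF H R]])
  show "t0_space (radon_prob_space X)"
    unfolding t0_space_def topspace_radon_prob_space
  proof (intro ballI impI)
    fix \<mu> \<nu> assume *: "\<mu> \<in> radon_probs X" "\<nu> \<in> radon_probs X" "\<mu> \<noteq> \<nu>"
    then obtain U where U: "openin X U" "measure \<mu> U \<noteq> measure \<nu> U"
      using radon_eqI_open by blast
    \<comment> \<open>Whichever of the two measures charges \<open>U\<close> more lies in this set, the other one does not.\<close>
    let ?W = "{\<kappa> \<in> radon_probs X. min (measure \<mu> U) (measure \<nu> U) < measure \<kappa> U}"
    have "openin (radon_prob_space X) ?W" "\<mu> \<notin> ?W \<longleftrightarrow> \<nu> \<in> ?W"
      using openin_measure_greater[OF U(1)] U(2) * by auto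
    then show "\<exists>W. openin (radon_prob_space X) W \<and> \<mu> \<notin> W = (\<nu> \<in> W)" by blast
  qed
qed

section \<open>Subspaces and the Dirac embedding\<close>

text \<open>
  Restrict the subproper map to the preimage of the image of \<open>X\<close>. The image of \<open>X\<close> need not be
  closed: a set that is precompact in \<open>X\<close> has a compact, hence closed, closure within \<open>X\<close>, and
  the preimage of that closure already contains the limit points in question.
\<close>

lemma k_star_metrizable_embedding:
  assumes e: "embedding_map X Y e" and X: "Hausdorff_space X" and Y: "k_star_metrizable_space Y"
  shows "k_star_metrizable_space X"
proof -
  obtain M :: "(nat \<Rightarrow> 'b) topology" and f where H: "Hausdorff_space Y" and M: "metrizable_space M"
    and f: "subproper_map M Y f"
    using Y unfolding k_star_metrizable_space_def by blast
  obtain Z where Z: "Z \<subseteq> topspace M" "f ` Z = topspace Y"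
    and pre: "\<And>K. precompactin Y K \<Longrightarrow> precompactin M (Z \<inter> f -` K)"
    and cf: "continuous_map M Y f"
    using f unfolding subproper_map_def by blast
  define E where "E = e ` topspace X"
  have hom: "homeomorphic_map X (subtopology Y E) e"
    using e unfolding embedding_map_def E_def .
  obtain g where g: "homeomorphic_maps X (subtopology Y E) e g"
    using hom homeomorphic_map_maps by blast
  have ce: "continuous_map X Y e" and cg: "continuous_map (subtopology Y E) X g"
    using g by (auto simp: homeomorphic_maps_def continuous_map_in_subtopology)
  have EY: "E \<subseteq> topspace Y"
    using ce by (auto simp: E_def continuous_map_def)
  have ge: "g (e x) = x" if "x \<in> topspace X" for x
    using g that by (simp add: homeomorphic_maps_def)
  have eg: "e (g y) = y" if "y \<in> E" for y
    using that ge by (auto simp: E_def)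
  define S where "S = {m \<in> topspace M. f m \<in> E}"
  have "continuous_map (subtopology M S) (subtopology Y E) f"
    using cf by (auto simp: continuous_map_in_subtopology S_def intro: continuous_map_from_subtopology)
  then have cgf: "continuous_map (subtopology M S) X (g \<circ> f)"
    using cg continuous_map_compose by blast
  have "subproper_map (subtopology M S) X (g \<circ> f)"
    unfolding subproper_map_def
  proof (intro conjI exI[of _ "Z \<inter> S"] allI impI)
    show "Z \<inter> S \<subseteq> topspace (subtopology M S)"
      using Z by auto
    have "f ` (Z \<inter> S) = E"
      using Z EY by (force simp: S_def)
    moreover have "g ` E = topspace X"
      using ge by (force simp: E_def)
    ultimately show "(g \<circ> f) ` (Z \<inter> S) = topspace X"
      by (simp only: image_comp[symmetric])
    fix K assume K: "precompactin X K"
    let ?A = "(Z \<inter> S) \<inter> (g \<circ> f) -` K"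
    let ?L = "e ` (X closure_of K)"
    have L: "compactin Y ?L"
      using K image_compactin ce unfolding precompactin_def by blast
    have cl: "Y closure_of (e ` K) \<subseteq> ?L"
      using K compactin_imp_closedin[OF H L] closure_of_subset[of K X]
      by (intro closure_of_minimal) (auto simp: precompactin_def)
    have "precompactin Y (e ` K)"
      unfolding precompactin_def
      using closed_compactin[OF L cl] K ce by (auto simp: precompactin_def continuous_map_def)
    then have C: "compactin M (M closure_of (Z \<inter> f -` (e ` K)))"
      using pre unfolding precompactin_def by blast
    have sub: "?A \<subseteq> Z \<inter> f -` (e ` K)"
    proof
      fix m assume m: "m \<in> ?A"
      then have "e (g (f m)) = f m" by (simp add: S_def eg)
      then show "m \<in> Z \<inter> f -` (e ` K)"
        using m by (metis IntD1 IntD2 IntI comp_apply imageI vimage_eq)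
    qed
    have C': "compactin M (M closure_of ?A)"
      using closed_compactin[OF C closure_of_mono[OF sub]] by simp
    have "M closure_of ?A \<subseteq> S"
    proof
      fix m assume m: "m \<in> M closure_of ?A"
      then have "f m \<in> f ` (M closure_of (Z \<inter> f -` (e ` K)))"
        using closure_of_mono[OF sub] by blast
      also have "\<dots> \<subseteq> Y closure_of (f ` (Z \<inter> f -` (e ` K)))"
        using continuous_map_image_closure_subset[OF cf] .
      also have "\<dots> \<subseteq> Y closure_of (e ` K)"
        by (intro closure_of_mono) auto
      also have "\<dots> \<subseteq> E"
        using cl closure_of_subset_topspace[of X K] by (auto simp: E_def)
      finally show "m \<in> S"
        using m closure_of_subset_topspace[of M ?A] by (auto simp: S_def)
    qed
    moreover have "S \<inter> ?A = ?A" by blast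
    ultimately show "precompactin (subtopology M S) ?A"
      using C' Z unfolding precompactin_def
      by (auto simp: closure_of_subtopology compactin_subtopology Int_absorb1)
  qed (rule cgf)
  then show ?thesis
    using k_star_metrizable_spaceI[OF X] metrizable_space_subtopology[OF M] by blast
qed

text \<open>
  The restricted section takes values in the preimage of \<open>X\<close>. Its accumulation points along a
  sequence that converges in \<open>X\<close> stay in the preimage, because continuity maps them to the limit.
\<close>

lemma cs_star_metrizable_embedding:
  assumes e: "embedding_map X Y e" and X: "Hausdorff_space X" and Y: "cs_star_metrizable_space Y"
  shows "cs_star_metrizable_space X"
proof -
  obtain M :: "(nat \<Rightarrow> 'b) topology" and f s where H: "Hausdorff_space Y" and M: "metrizable_space M"
    and cf: "continuous_map M Y f" and s: "section_of M Y f s" and cs: "cs_star_continuous Y M s"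
    using Y unfolding cs_star_metrizable_space_def by blast
  define E where "E = e ` topspace X"
  have hom: "homeomorphic_map X (subtopology Y E) e"
    using e unfolding embedding_map_def E_def .
  obtain g where g: "homeomorphic_maps X (subtopology Y E) e g"
    using hom homeomorphic_map_maps by blast
  have ce: "continuous_map X Y e" and cg: "continuous_map (subtopology Y E) X g"
    using g by (auto simp: homeomorphic_maps_def continuous_map_in_subtopology)
  have ge: "g (e x) = x" if "x \<in> topspace X" for x
    using g that by (simp add: homeomorphic_maps_def)
  have eY: "e x \<in> topspace Y" if "x \<in> topspace X" for x
    using ce that by (auto simp: continuous_map_def)
  have sM: "s y \<in> topspace M" "f (s y) = y" if "y \<in> topspace Y" for y
    using s that by (auto simp: section_of_def)
  define S where "S = {m \<in> topspace M. f m \<in> E}"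
  have "continuous_map (subtopology M S) (subtopology Y E) f"
    using cf by (auto simp: continuous_map_in_subtopology S_def intro: continuous_map_from_subtopology)
  then have cgf: "continuous_map (subtopology M S) X (g \<circ> f)"
    using cg continuous_map_compose by blast
  have se: "s \<circ> e \<in> topspace X \<rightarrow> topspace (subtopology M S)"
    using sM eY by (auto simp: S_def E_def)
  have sec: "section_of (subtopology M S) X (g \<circ> f) (s \<circ> e)"
    using se sM eY ge by (auto simp: section_of_def)
  have "cs_star_continuous X (subtopology M S) (s \<circ> e)"
    unfolding cs_star_continuous_def
  proof (intro conjI se allI impI)
    fix y assume y: "convergent_seq_in X y"
    then obtain l where l: "limitin X y l sequentially" and yX: "range y \<subseteq> topspace X"
      by (auto simp: convergent_seq_in_def)
    have lY: "limitin Y (e \<circ> y) (e l) sequentially"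
      using continuous_map_limit[OF ce l] .
    then have "convergent_seq_in Y (e \<circ> y)"
      using yX eY by (auto simp: convergent_seq_in_def)
    then obtain p where p: "accumulation_point_in M (s \<circ> (e \<circ> y)) p"
      using cs unfolding cs_star_continuous_def by blast
    then have pM: "p \<in> topspace M" by (simp add: accumulation_point_in_def)
    \<comment> \<open>The image of the accumulation point can only be the limit of the sequence.\<close>
    have "f p = e l"
    proof (rule ccontr)
      assume "f p \<noteq> e l"
      moreover have "f p \<in> topspace Y" "e l \<in> topspace Y"
        using cf pM limitin_topspace[OF lY] by (auto simp: continuous_map_def)
      ultimately obtain U V where UV: "openin Y U" "openin Y V" "f p \<in> U" "e l \<in> V" "disjnt U V"
        using H unfolding Hausdorff_space_def by metis
      have "openin M {m \<in> topspace M. f m \<in> U}"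
        using cf UV(1) by (simp add: continuous_map_def)
      then have "infinite {n. (s \<circ> (e \<circ> y)) n \<in> {m \<in> topspace M. f m \<in> U}}"
        using p pM UV(3) unfolding accumulation_point_in_def by blast
      moreover have "{n. (s \<circ> (e \<circ> y)) n \<in> {m \<in> topspace M. f m \<in> U}} \<subseteq> {n. e (y n) \<notin> V}"
      proof
        fix n assume n: "n \<in> {n. (s \<circ> (e \<circ> y)) n \<in> {m \<in> topspace M. f m \<in> U}}"
        have "y n \<in> topspace X" using yX by blast
        then have "f (s (e (y n))) = e (y n)" using sM eY by blast
        then show "n \<in> {n. e (y n) \<notin> V}"
          using n UV(5) by (auto simp: disjnt_iff)
      qed
      moreover have "finite {n. e (y n) \<notin> V}"
      proof -
        have "\<forall>\<^sub>F n in sequentially. (e \<circ> y) n \<in> V"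
          using lY UV(2,4) by (auto simp: limitin_def)
        then obtain N where "\<And>n. n \<ge> N \<Longrightarrow> e (y n) \<in> V"
          by (auto simp: eventually_sequentially)
        then have "{n. e (y n) \<notin> V} \<subseteq> {..<N}" by (auto simp: not_le[symmetric])
        then show ?thesis using finite_subset by blast
      qed
      ultimately show False using finite_subset by blast
    qed
    then have pS: "p \<in> S"
      using pM limitin_topspace[OF l] by (auto simp: S_def E_def)
    have "accumulation_point_in (subtopology M S) (s \<circ> e \<circ> y) p"
      unfolding accumulation_point_in_def
    proof (intro conjI allI impI)
      show "p \<in> topspace (subtopology M S)" using pM pS by simp
      fix U assume U: "openin (subtopology M S) U \<and> p \<in> U"
      then obtain T where T: "openin M T" "U = T \<inter> S"
        by (auto simp: openin_subtopology)
      then have "infinite {n. (s \<circ> (e \<circ> y)) n \<in> T}"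
        using p U by (auto simp: accumulation_point_in_def)
      moreover have "{n. (s \<circ> (e \<circ> y)) n \<in> T} \<subseteq> {n. (s \<circ> e \<circ> y) n \<in> U}"
        using se yX by (force simp: T(2) Pi_iff)
      ultimately show "infinite {n. (s \<circ> e \<circ> y) n \<in> U}"
        using infinite_super by blast
    qed
    then show "\<exists>p. accumulation_point_in (subtopology M S) (s \<circ> e \<circ> y) p" by blast
  qed
  then show ?thesis
    using cs_star_metrizable_spaceI[OF X metrizable_space_subtopology[OF M] cgf sec] by blast
qed

lemma aleph0_embedding:
  assumes e: "embedding_map X Y e" and X: "Hausdorff_space X" "regular_space X"
    and Y: "aleph0_space Y"
  shows "aleph0_space X"
proof -
  obtain N where N: "countable N" "k_network Y N"
    using Y by (auto simp: aleph0_space_def)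
  let ?r = "\<lambda>A. {x \<in> topspace X. e x \<in> A}"
  have hom: "homeomorphic_map X (subtopology Y (e ` topspace X)) e"
    using e unfolding embedding_map_def .
  have ce: "continuous_map X Y e"
    using homeomorphic_imp_continuous_map[OF hom] by (simp add: continuous_map_in_subtopology)
  have "k_network X (?r ` N)"
    unfolding k_network_def
  proof (intro conjI allI impI)
    fix U K assume UK: "openin X U \<and> compactin X K \<and> K \<subseteq> U"
    then have "openin (subtopology Y (e ` topspace X)) (e ` U)"
      using homeomorphic_imp_open_map[OF hom] by (simp add: open_map_def)
    then obtain W where W: "openin Y W" "e ` U = W \<inter> e ` topspace X"
      by (auto simp: openin_subtopology)
    have "compactin Y (e ` K)"
      using UK image_compactin[OF _ ce] by blast
    moreover have "e ` K \<subseteq> W"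
      using UK W(2) by blast
    ultimately obtain F where F: "F \<subseteq> N" "finite F" "e ` K \<subseteq> \<Union>F" "\<Union>F \<subseteq> W"
      using N(2) W(1) unfolding k_network_def by meson
    have "?r W \<subseteq> U"
    proof
      fix x assume "x \<in> ?r W"
      then have "e x \<in> e ` U" "x \<in> topspace X" using W(2) by auto
      then show "x \<in> U"
        using homeomorphic_imp_injective_map[OF hom] UK openin_subset inj_on_image_mem_iff by metis
    qed
    moreover have "K \<subseteq> \<Union>(?r ` F)"
      using F(3) UK compactin_subset_topspace by fastforce
    moreover have "\<Union>(?r ` F) \<subseteq> ?r W"
      using F(4) by blast
    ultimately show "\<exists>F\<subseteq>?r ` N. finite F \<and> K \<subseteq> \<Union>F \<and> \<Union>F \<subseteq> U"
      using F(1,2) by (intro exI[of _ "?r ` F"]) (auto simp: subset_trans)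
  qed auto
  then show ?thesis
    using X N(1) unfolding aleph0_space_def by blast
qed

lemma space_borel_sigma: "space (borel_sigma X) = topspace X"
  by (simp add: borel_sigma_def space_measure_of_conv)

lemma dirac_radon:
  assumes x: "x \<in> topspace X"
  shows "return (borel_sigma X) x \<in> radon_probs X"
  unfolding radon_probs_def
proof (intro CollectI conjI allI impI ballI)
  show "prob_space (return (borel_sigma X) x)"
    using x by (intro prob_space_return) (simp add: space_borel_sigma)
  fix \<epsilon> :: real and B assume \<epsilon>: "\<epsilon> > 0" and B: "B \<in> sets (return (borel_sigma X) x)"
  have "measure (return (borel_sigma X) x) (B - {x}) = 0"
    by (cases "B - {x} \<in> sets (borel_sigma X)") (simp_all add: measure_return measure_notin_sets)
  moreover have "B - B \<inter> {x} = B - {x}" by blast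
  moreover have "compactin X (B \<inter> {x})"
    using x by (cases "x \<in> B") auto
  ultimately show "\<exists>K\<subseteq>B. compactin X K \<and> measure (return (borel_sigma X) x) (B - K) < \<epsilon>"
    using \<epsilon> by (intro exI[of _ "B \<inter> {x}"]) simp
qed simp

text \<open>
  A subbasic set \<open>\<mu> U > a\<close> contains all point masses, those at points of \<open>U\<close>, or none, according
  to \<open>a\<close>.
\<close>

lemma embedding_map_dirac:
  assumes H: "Hausdorff_space X"
  shows "embedding_map X (radon_prob_space X) (return (borel_sigma X))"
proof -
  let ?P = "radon_prob_space X" and ?\<delta> = "return (borel_sigma X)"
  have val: "measure (?\<delta> x) U = indicator U x" if "x \<in> topspace X" "openin X U" for x U
    using open_in_sets_radon[OF dirac_radon[OF that(1)] that(2)]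
    by (simp add: measure_return)
  have "continuous_map X ?P ?\<delta>"
    unfolding radon_prob_space_def
  proof (rule continuous_on_generated_topo)
    show "?\<delta> ` topspace X \<subseteq> \<Union>{{\<mu> \<in> radon_probs X. measure \<mu> U > a} |a U. openin X U}"
      using topspace_radon_prob_space[of X] dirac_radon
      by (auto simp: radon_prob_space_def)
    fix W assume "W \<in> {{\<mu> \<in> radon_probs X. measure \<mu> U > a} |a U. openin X U}"
    then obtain a U where W: "W = {\<mu> \<in> radon_probs X. measure \<mu> U > a}" and U: "openin X U"
      by blast
    have "?\<delta> -` W \<inter> topspace X = {x \<in> topspace X. a < indicator U x}"
      using dirac_radon val U by (auto simp: W)
    also have "\<dots> = (if a < 0 then topspace X else if a < 1 then U else {})"
      using openin_subset[OF U] by (auto simp: indicator_def)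
    finally show "openin X (?\<delta> -` W \<inter> topspace X)"
      using U by simp
  qed
  moreover have "open_map X (subtopology ?P (?\<delta> ` topspace X)) ?\<delta>"
    unfolding open_map_def
  proof (intro allI impI)
    fix U assume U: "openin X U"
    have "?\<delta> ` U = {\<mu> \<in> radon_probs X. 1/2 < measure \<mu> U} \<inter> ?\<delta> ` topspace X"
    proof safe
      fix x assume "x \<in> topspace X" "1/2 < measure (?\<delta> x) U"
      then have "x \<in> U" using val[OF _ U, of x] by (cases "x \<in> U") auto
      then show "?\<delta> x \<in> ?\<delta> ` U" by blast
    next
      fix x assume "x \<in> U"
      moreover from this have "x \<in> topspace X" using openin_subset[OF U] by blast
      ultimately show "?\<delta> x \<in> radon_probs X" "1/2 < measure (?\<delta> x) U" "?\<delta> x \<in> ?\<delta> ` topspace X"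
        using dirac_radon val[OF _ U, of x] by auto
    qed
    then show "openin (subtopology ?P (?\<delta> ` topspace X)) (?\<delta> ` U)"
      using openin_measure_greater[OF U, of "1/2"] unfolding openin_subtopology by blast
  qed
  moreover have "inj_on ?\<delta> (topspace X)"
  proof (rule inj_onI, rule ccontr)
    fix x y assume xy: "x \<in> topspace X" "y \<in> topspace X" "?\<delta> x = ?\<delta> y" "x \<noteq> y"
    have "openin X (topspace X - {y})"
      using H xy(2) closedin_Hausdorff_sing_eq by (metis openin_diff openin_topspace)
    then show False
      using val[of x "topspace X - {y}"] val[of y "topspace X - {y}"] xy by simp
  qed
  moreover have "?\<delta> ` topspace X \<subseteq> topspace ?P"
    using dirac_radon by (auto simp: topspace_radon_prob_space)
  ultimately show ?thesis
    unfolding embedding_map_def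
    by (intro bijective_open_imp_homeomorphic_map)
      (auto simp: continuous_map_in_subtopology)
qed

section \<open>Networks and convergent sequences\<close>

lemma k_networkE:
  assumes "k_network X N" "openin X U" "compactin X K" "K \<subseteq> U"
  obtains F where "F \<subseteq> N" "finite F" "K \<subseteq> \<Union>F" "\<Union>F \<subseteq> U"
proof -
  have "\<exists>F\<subseteq>N. finite F \<and> K \<subseteq> \<Union>F \<and> \<Union>F \<subseteq> U"
    using assms unfolding k_network_def by simp
  then show thesis
    by (elim exE conjE) (rule that)
qed

text \<open>
  The injection is a homeomorphism from the compact set to its image, which is metrizable and
  compact, hence sequentially compact.
\<close>

lemma compactin_imp_seq_compact_if_injection:
  assumes J: "continuous_map P T J" "inj_on J (topspace P)" and T: "metrizable_space T"
    and K: "compactin P K" and \<sigma>: "range (\<sigma> :: nat \<Rightarrow> _) \<subseteq> K"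
  obtains l r where "l \<in> K" "strict_mono r" "limitin P (\<sigma> \<circ> r) l sequentially"
proof -
  obtain D d where "Metric_space D d" and Td: "T = Metric_space.mtopology D d"
    using T unfolding metrizable_space_def by blast
  then interpret Metric_space D d by simp
  have KP: "K \<subseteq> topspace P"
    using K compactin_subset_topspace by blast
  have "compactin mtopology (J ` K)"
    using image_compactin[OF K J(1)] Td by simp
  moreover have "range (J \<circ> \<sigma>) \<subseteq> J ` K" using \<sigma> by auto
  ultimately obtain m r where m: "m \<in> J ` K" "strict_mono r"
      "limitin T ((J \<circ> \<sigma>) \<circ> r) m sequentially"
    unfolding compactin_sequentially Td by blast
  have "homeomorphic_map (subtopology P K) (subtopology T (J ` K)) J"
  proof (rule continuous_imp_homeomorphic_map)
    show "continuous_map (subtopology P K) (subtopology T (J ` K)) J"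
      using J(1) by (auto simp: continuous_map_in_subtopology continuous_map_from_subtopology)
    show "compact_space (subtopology P K)"
      using K compact_space_subtopology by blast
    show "Hausdorff_space (subtopology T (J ` K))"
      using metrizable_imp_Hausdorff_space[OF T] Hausdorff_space_subtopology by blast
    show "J ` topspace (subtopology P K) = topspace (subtopology T (J ` K))"
      using J(1) KP by (auto simp: continuous_map_def Pi_iff)
    show "inj_on J (topspace (subtopology P K))"
      using J(2) by (auto intro: inj_on_subset)
  qed
  then obtain g where g: "homeomorphic_maps (subtopology P K) (subtopology T (J ` K)) J g"
    using homeomorphic_map_maps by blast
  have gJ: "g (J x) = x" if "x \<in> K" for x
    using g that KP by (auto simp: homeomorphic_maps_def)
  have cg: "continuous_map (subtopology T (J ` K)) (subtopology P K) g"
    using g by (simp add: homeomorphic_maps_def)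
  have "limitin (subtopology T (J ` K)) (J \<circ> (\<sigma> \<circ> r)) m sequentially"
    using m \<sigma> by (auto simp: limitin_subtopology comp_assoc intro!: always_eventually)
  then have "limitin (subtopology P K) (g \<circ> (J \<circ> (\<sigma> \<circ> r))) (g m) sequentially"
    by (rule continuous_map_limit[OF cg])
  moreover have "g \<circ> (J \<circ> (\<sigma> \<circ> r)) = \<sigma> \<circ> r"
    using gJ \<sigma> by (auto simp: fun_eq_iff)
  ultimately have "limitin P (\<sigma> \<circ> r) (g m) sequentially" "g m \<in> K"
    by (auto simp: limitin_subtopology)
  then show thesis using that m(2) by blast
qed

text \<open>
  If no finite union of members inside \<open>U\<close> covers \<open>K\<close>, choose the \<open>n\<close>-th point of a sequence in
  \<open>K\<close> outside the first \<open>n\<close> of these members. By sequential compactness some member inside \<open>U\<close>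
  contains infinitely many of the points, against the choice.
\<close>

lemma k_networkI_convergent_seq:
  assumes N: "countable N" "N \<subseteq> Pow (topspace P)"
    and cs: "\<And>\<sigma> l W. \<lbrakk>range \<sigma> \<subseteq> topspace P; limitin P \<sigma> l sequentially; openin P W; l \<in> W\<rbrakk>
      \<Longrightarrow> \<exists>A\<in>N. A \<subseteq> W \<and> infinite {n. \<sigma> n \<in> A}"
    and seq: "\<And>K (\<sigma> :: nat \<Rightarrow> _). \<lbrakk>compactin P K; range \<sigma> \<subseteq> K\<rbrakk>
      \<Longrightarrow> \<exists>l r. l \<in> K \<and> strict_mono r \<and> limitin P (\<sigma> \<circ> r) l sequentially"
  shows "k_network P N"
  unfolding k_network_def
proof (intro conjI N allI impI)
  fix U K assume UK: "openin P U \<and> compactin P K \<and> K \<subseteq> U"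
  \<comment> \<open>The empty set is only added to have something to enumerate.\<close>
  define N' where "N' = insert {} {A \<in> N. A \<subseteq> U}"
  have cN: "countable N'"
    using N(1) by (simp add: N'_def)
  define a where "a = from_nat_into N'"
  have a: "a i \<noteq> {} \<Longrightarrow> a i \<in> N \<and> a i \<subseteq> U" for i
    using from_nat_into[of N' i] by (auto simp: a_def N'_def)
  show "\<exists>F\<subseteq>N. finite F \<and> K \<subseteq> \<Union>F \<and> \<Union>F \<subseteq> U"
  proof (rule ccontr)
    assume no: "\<not> ?thesis"
    have "\<exists>x\<in>K. \<forall>i\<le>n. x \<notin> a i" for n
    proof (rule ccontr)
      assume K: "\<not> ?thesis"
      define F where "F = a ` {i. i \<le> n \<and> a i \<noteq> {}}"
      have "F \<subseteq> N" "finite F" "\<Union>F \<subseteq> U"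
        using a by (auto simp: F_def)
      moreover have "K \<subseteq> \<Union>F"
      proof
        fix x assume "x \<in> K"
        then obtain i where "i \<le> n" "x \<in> a i" using K by blast
        then show "x \<in> \<Union>F" by (auto simp: F_def)
      qed
      ultimately have "\<exists>F\<subseteq>N. finite F \<and> K \<subseteq> \<Union>F \<and> \<Union>F \<subseteq> U"
        by (intro exI[of _ F] conjI)
      with no show False by (rule notE)
    qed
    then obtain \<sigma> where \<sigma>: "\<And>n. \<sigma> n \<in> K" "\<And>n i. i \<le> n \<Longrightarrow> \<sigma> n \<notin> a i"
      by metis
    obtain l r where l: "l \<in> K" and r: "strict_mono r" "limitin P (\<sigma> \<circ> r) l sequentially"
      using seq[of K \<sigma>] UK \<sigma>(1) by blast
    have "range (\<sigma> \<circ> r) \<subseteq> topspace P"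
      using \<sigma>(1) UK compactin_subset_topspace[of P K] by auto
    from cs[OF this r(2), of U] UK l
    obtain A where A: "A \<in> N" "A \<subseteq> U" and inf: "infinite {n. (\<sigma> \<circ> r) n \<in> A}"
      by auto
    obtain j where j: "a j = A"
      using from_nat_into_surj[OF cN, of A] A unfolding a_def N'_def by blast
    obtain n where n: "n \<ge> j" "\<sigma> (r n) \<in> A"
      using inf unfolding infinite_nat_iff_unbounded_le by auto
    have "j \<le> r n"
      using n(1) seq_suble[OF r(1), of n] by linarith
    then show False
      using \<sigma>(2)[of j "r n"] n(2) j by auto
  qed
qed

text \<open>
  Two points are separated by a function that is below \<open>1/3\<close> at one and above \<open>2/3\<close> at the other,
  hence also near them. Thus one function for each pair of network elements that can be separated
  in this way suffices.
\<close>

lemma aleph0_continuous_injection: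
  fixes X :: "'a topology"
  assumes X: "completely_regular_space X" "Hausdorff_space X" and N: "aleph0_space X"
  obtains J :: "'a \<Rightarrow> nat \<Rightarrow> real" where "continuous_map X euclidean J" "inj_on J (topspace X)"
proof -
  obtain N where N: "countable N" "k_network X N"
    using assms(3) by (auto simp: aleph0_space_def)
  define sep where "sep = (\<lambda>(A, B) h. continuous_map X euclideanreal h \<and>
      (\<forall>x\<in>A. h x < 1/3) \<and> (\<forall>x\<in>B. 2/3 < h x))"
  define g where "g p = (if \<exists>h. sep p h then SOME h. sep p h else (\<lambda>_. 0))" for p
  have g: "sep p (g p)" if "sep p h" for p h
    using that someI[of "sep p"] by (auto simp: g_def)
  have cg: "continuous_map X euclideanreal (g p)" for p
  proof (cases "\<exists>h. sep p h")
    case True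
    then show ?thesis using g by (auto simp: sep_def split: prod.splits)
  next
    case False
    then show ?thesis by (simp add: g_def)
  qed
  define J where "J = (\<lambda>x i. g (from_nat_into (N \<times> N) i) x)"
  have "continuous_map X (product_topology (\<lambda>i. euclideanreal) UNIV) J"
    unfolding continuous_map_componentwise_UNIV J_def using cg by simp
  then have "continuous_map X euclidean J"
    by (simp add: euclidean_product_topology)
  moreover have "inj_on J (topspace X)"
  proof (rule inj_onI, rule ccontr)
    fix x y assume xy: "x \<in> topspace X" "y \<in> topspace X" "J x = J y" "x \<noteq> y"
    \<comment> \<open>A function separating the two points also separates network elements around them.\<close>
    have "closedin X {y}"
      using closedin_Hausdorff_sing_eq[OF X(2)] xy(2) by blast
    then obtain h where h: "continuous_map X (top_of_set {0..1::real}) h" "h x = 0" "h y = 1"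
      using X(1)[unfolded completely_regular_space_def, rule_format, of "{y}" x] xy(1,4) by auto
    have ch: "continuous_map X euclideanreal h"
      using h(1) by (simp add: continuous_map_in_subtopology)
    let ?U = "{z \<in> topspace X. h z \<in> {..<1/3}}" and ?V = "{z \<in> topspace X. h z \<in> {2/3<..}}"
    have UV: "openin X ?U" "openin X ?V"
      by (rule openin_continuous_map_preimage[OF ch], simp)+
    have net: "\<exists>A\<in>N. z \<in> A \<and> A \<subseteq> U" if zU: "openin X U" "z \<in> U" for z U
    proof -
      have z: "compactin X {z}" "{z} \<subseteq> U" using openin_subset[OF zU(1)] zU(2) by auto
      obtain F where F: "F \<subseteq> N" "finite F" "{z} \<subseteq> \<Union>F" "\<Union>F \<subseteq> U"
        by (rule k_networkE[OF N(2) zU(1) z])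
      then obtain A where "A \<in> F" "z \<in> A" by auto
      then show ?thesis using F(1,4) by (intro bexI[of _ A]) auto
    qed
    have "x \<in> ?U" "y \<in> ?V" using xy h by auto
    with net[OF UV(1)] net[OF UV(2)] obtain A B where AB: "A \<in> N" "x \<in> A" "A \<subseteq> ?U"
        "B \<in> N" "y \<in> B" "B \<subseteq> ?V"
      by blast
    have "sep (A, B) h"
      using AB ch by (auto simp: sep_def)
    then have "g (A, B) x < 1/3" "2/3 < g (A, B) y"
      using g[of "(A, B)"] AB by (auto simp: sep_def)
    moreover obtain i where "from_nat_into (N \<times> N) i = (A, B)"
      using from_nat_into_surj[of "N \<times> N" "(A, B)"] N(1) AB by auto
    ultimately have "J x i < J y i" by (simp add: J_def)
    then show False using xy(3) by simp
  qed
  ultimately show thesis using that by blast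
qed

text \<open>
  The compact \<open>L\<close> expresses inner measure, so that a network element \<open>A\<close> need not be a Borel set.
\<close>

definition radon_subbox :: "'a topology \<Rightarrow> 'a set \<Rightarrow> real \<Rightarrow> 'a measure set" where
  "radon_subbox X A q = {\<mu> \<in> radon_probs X. \<exists>L\<subseteq>A. compactin X L \<and> q < measure \<mu> L}"

text \<open>
  Cut a neighbourhood \<open>C \<subseteq> U\<close> down to a compact set \<open>C \<inter> K\<close>, where \<open>K\<close> carries almost all of the
  mass of all \<open>\<sigma> n\<close> at once; a finite union of network elements then fits between \<open>C \<inter> K\<close> and
  \<open>U\<close>.
\<close>

lemma radon_subbox_eventually:
  assumes H: "Hausdorff_space X" and R: "regular_space X" and N: "k_network X N"
    and tight: "uniformly_tight X (range \<sigma>)"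
    and lim: "limitin (radon_prob_space X) \<sigma> \<nu> sequentially"
    and U: "openin X U" and a: "a < measure \<nu> U"
  obtains A q where "A \<in> {\<Union>F | F. finite F \<and> F \<subseteq> N}" "q \<in> \<rat>" "radon_subbox X A q \<subseteq> {\<mu> \<in> radon_probs X. a < measure \<mu> U}"
    "\<forall>\<^sub>F n in sequentially. \<sigma> n \<in> radon_subbox X A q"
proof -
  have \<nu>: "\<nu> \<in> radon_probs X"
    using limitin_topspace[OF lim] by (simp add: topspace_radon_prob_space)
  have \<sigma>: "\<sigma> n \<in> radon_probs X" for n
    using tight by (auto simp: uniformly_tight_def)
  obtain q where q: "q \<in> \<rat>" "a < q" "q < measure \<nu> U"
    using Rats_dense_in_real[OF a] by blast
  obtain b where b: "q < b" "b < measure \<nu> U"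
    using q(3) dense by blast
  obtain V C where VC: "openin X V" "closedin X C" "V \<subseteq> C" "C \<subseteq> U" "b < measure \<nu> V"
    using radon_inner_open[OF \<nu> H R U b(2)] by blast
  obtain K where K: "compactin X K" and tK: "\<And>n. measure (\<sigma> n) (topspace X - K) < b - q"
  proof -
    have "\<exists>K. compactin X K \<and> (\<forall>\<mu>\<in>range \<sigma>. measure \<mu> (topspace X - K) < b - q)"
      using tight b(1) unfolding uniformly_tight_def by simp
    then show thesis using that by auto
  qed
  have L: "compactin X (C \<inter> K)"
    using closed_Int_compactin[OF VC(2) K] .
  obtain F where F: "F \<subseteq> N" "finite F" "C \<inter> K \<subseteq> \<Union>F" "\<Union>F \<subseteq> U"
    using k_networkE[OF N U L le_infI1[OF VC(4)]] .
  have "radon_subbox X (\<Union>F) q \<subseteq> {\<mu> \<in> radon_probs X. a < measure \<mu> U}"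
  proof
    fix \<mu> assume "\<mu> \<in> radon_subbox X (\<Union>F) q"
    then obtain L where L: "\<mu> \<in> radon_probs X" "L \<subseteq> \<Union>F" "q < measure \<mu> L"
      by (auto simp: radon_subbox_def)
    have "L \<subseteq> U" using L(2) F(4) by (rule subset_trans)
    then have "measure \<mu> L \<le> measure \<mu> U"
      by (rule measure_mono_radon[OF L(1) open_in_sets_radon[OF L(1) U]])
    then show "\<mu> \<in> {\<mu> \<in> radon_probs X. a < measure \<mu> U}"
      using L(1,3) q(2) by simp
  qed
  moreover have "\<forall>\<^sub>F n in sequentially. \<sigma> n \<in> radon_subbox X (\<Union>F) q"
    using limitin_measure_greater[OF lim VC(1,5)]
  proof eventually_elim
    case (elim n)
    interpret prob_space "\<sigma> n" using radon_probsD(1)[OF \<sigma>] .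
    have m: "V \<in> sets (\<sigma> n)" "C \<in> sets (\<sigma> n)" "K \<in> sets (\<sigma> n)"
      using open_in_sets_radon[OF \<sigma> VC(1)] closed_in_sets_radon[OF \<sigma> VC(2)]
        compact_in_sets_radon[OF \<sigma> H K] by auto
    have sp: "topspace X \<in> sets (\<sigma> n)"
      using open_in_sets_radon[OF \<sigma> openin_topspace] .
    have "measure (\<sigma> n) V \<le> measure (\<sigma> n) ((C \<inter> K) \<union> (topspace X - K))"
      using VC(3) openin_subset[OF VC(1)] m sp by (intro finite_measure_mono) auto
    also have "\<dots> \<le> measure (\<sigma> n) (C \<inter> K) + measure (\<sigma> n) (topspace X - K)"
      using m sp by (intro measure_Un_le) auto
    finally have "q < measure (\<sigma> n) (C \<inter> K)"
      using elim tK[of n] by linarith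
    then show ?case
      using L F(3) \<sigma> unfolding radon_subbox_def by blast
  qed
  ultimately show thesis using that[of "\<Union>F" q] F(1,2) q(1) by auto
qed

lemma aleph0_radon_prob_spaceI:
  assumes H: "Hausdorff_space X" and R: "regular_space X" and A: "aleph0_space X"
    and P: "sequentially_prohorov X"
    and seq: "\<And>K (\<sigma> :: nat \<Rightarrow> _). \<lbrakk>compactin (radon_prob_space X) K; range \<sigma> \<subseteq> K\<rbrakk>
      \<Longrightarrow> \<exists>l r. l \<in> K \<and> strict_mono r \<and> limitin (radon_prob_space X) (\<sigma> \<circ> r) l sequentially"
  shows "aleph0_space (radon_prob_space X)"
proof -
  let ?P = "radon_prob_space X"
  obtain N where N: "countable N" "k_network X N"
    using A by (auto simp: aleph0_space_def)
  define N' where "N' = {\<Union>F | F. finite F \<and> F \<subseteq> N}"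
  have "N' = Union ` {F. finite F \<and> F \<subseteq> N}"
    by (auto simp: N'_def)
  then have N': "countable N'"
    using countable_Collect_finite_subset[OF N(1)] by simp
  define S where "S = (\<lambda>(A, q). radon_subbox X A q) ` (N' \<times> \<rat>)"
  define G where "G = (\<lambda>F. radon_probs X \<inter> \<Inter>F) ` {F. finite F \<and> F \<subseteq> S}"
  have "countable S"
    unfolding S_def using N' countable_rat by (intro countable_image countable_SIGMA) auto
  then have cG: "countable G"
    unfolding G_def by (intro countable_image countable_Collect_finite_subset)
  have G_Int: "B \<inter> B' \<in> G" if BB: "B \<in> G" "B' \<in> G" for B B'
  proof -
    obtain F F' where "finite F" "F \<subseteq> S" "B = radon_probs X \<inter> \<Inter>F"
        "finite F'" "F' \<subseteq> S" "B' = radon_probs X \<inter> \<Inter>F'"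
      using BB by (auto simp: G_def)
    then show ?thesis
      unfolding G_def by (intro image_eqI[of _ _ "F \<union> F'"]) auto
  qed
  have main: "\<exists>B\<in>G. B \<subseteq> W \<and> (\<forall>\<^sub>F n in sequentially. \<sigma> n \<in> B)"
    if "generate_topology_on {{\<mu> \<in> radon_probs X. measure \<mu> U > a} | a U. openin X U} W" "\<nu> \<in> W"
      and lim: "limitin ?P \<sigma> \<nu> sequentially" and tight: "uniformly_tight X (range \<sigma>)" for W \<sigma> \<nu>
    using that(1,2)
  proof induction
    case Empty
    then show ?case by simp
  next
    case (Int W W')
    from Int.IH(1) Int.prems obtain B where B: "B \<in> G" "B \<subseteq> W" "\<forall>\<^sub>F n in sequentially. \<sigma> n \<in> B"
      by blast
    from Int.IH(2) Int.prems obtain B' where B': "B' \<in> G" "B' \<subseteq> W'" "\<forall>\<^sub>F n in sequentially. \<sigma> n \<in> B'"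
      by blast
    have "\<forall>\<^sub>F n in sequentially. \<sigma> n \<in> B \<inter> B'"
      using B(3) B'(3) by eventually_elim simp
    then show ?case
      using G_Int[OF B(1) B'(1)] B(2) B'(2) by (intro bexI[of _ "B \<inter> B'"]) auto
  next
    case (UN \<W>)
    then obtain W where W: "W \<in> \<W>" "\<nu> \<in> W" by blast
    from UN.IH[OF W] obtain B where "B \<in> G" "B \<subseteq> W" "\<forall>\<^sub>F n in sequentially. \<sigma> n \<in> B"
      by blast
    then show ?case using W(1) by (intro bexI[of _ B]) auto
  next
    case (Basis W)
    then obtain a U where W: "W = {\<mu> \<in> radon_probs X. measure \<mu> U > a}" and U: "openin X U"
      by blast
    have a: "a < measure \<nu> U" using Basis.prems unfolding W by simp
    obtain A q where Aq: "A \<in> {\<Union>F | F. finite F \<and> F \<subseteq> N}" "q \<in> \<rat>"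
        "radon_subbox X A q \<subseteq> {\<mu> \<in> radon_probs X. a < measure \<mu> U}"
        "\<forall>\<^sub>F n in sequentially. \<sigma> n \<in> radon_subbox X A q"
      by (rule radon_subbox_eventually[OF H R N(2) tight lim U a])
    have "A \<in> N'" using Aq(1) unfolding N'_def .
    have "radon_subbox X A q \<in> S"
      using \<open>A \<in> N'\<close> Aq(2) unfolding S_def by (intro image_eqI[of _ _ "(A, q)"]) auto
    then have "radon_probs X \<inter> \<Inter>{radon_subbox X A q} \<in> G"
      unfolding G_def by (intro image_eqI[of _ _ "{radon_subbox X A q}"]) auto
    moreover have "radon_probs X \<inter> \<Inter>{radon_subbox X A q} = radon_subbox X A q"
      by (auto simp: radon_subbox_def)
    ultimately show ?case
      using Aq(3,4) unfolding W by (intro bexI[of _ "radon_subbox X A q"] conjI) simp_all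
  qed
  have "k_network ?P G"
  proof (rule k_networkI_convergent_seq[OF cG _ _ seq])
    show "G \<subseteq> Pow (topspace ?P)"
      by (auto simp: G_def topspace_radon_prob_space)
    fix \<sigma> l W
    assume *: "range \<sigma> \<subseteq> topspace ?P" "limitin ?P \<sigma> l sequentially" "openin ?P W" "l \<in> W"
    have "uniformly_tight X (range \<sigma>)"
      using P *(1,2) unfolding sequentially_prohorov_def convergent_seq_in_def by blast
    moreover have "generate_topology_on {{\<mu> \<in> radon_probs X. measure \<mu> U > a} | a U. openin X U} W"
      using *(3) by (simp add: radon_prob_space_def openin_topology_generated_by_iff)
    ultimately obtain B where B: "B \<in> G" "B \<subseteq> W" "\<forall>\<^sub>F n in sequentially. \<sigma> n \<in> B"
      using main *(2,4) by blast
    have "infinite {n. \<sigma> n \<in> B}"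
      using B(3) unfolding infinite_nat_iff_unbounded_le eventually_sequentially
      by (meson max.cobounded1 max.cobounded2 mem_Collect_eq)
    then show "\<exists>B\<in>G. B \<subseteq> W \<and> infinite {n. \<sigma> n \<in> B}"
      using B by blast
  qed
  then show ?thesis
    using cG Hausdorff_radon_prob_space[OF H R] regular_radon_prob_space[OF H R]
    by (auto simp: aleph0_space_def)
qed

section \<open>Functionals on Lipschitz functions\<close>

text \<open>
  Rounding down to multiples of \<open>\<epsilon>\<close> leaves finitely many patterns of values on \<open>I\<close>.
\<close>

lemma finite_approximation:
  fixes g :: "'a \<Rightarrow> 'b \<Rightarrow> real"
  assumes I: "finite I" and \<epsilon>: "\<epsilon> > 0"
    and g: "\<And>a i. \<lbrakk>a \<in> A; i \<in> I\<rbrakk> \<Longrightarrow> 0 \<le> g a i \<and> g a i \<le> 1"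
  obtains B where "finite B" "B \<subseteq> A" "\<And>a. a \<in> A \<Longrightarrow> \<exists>b\<in>B. \<forall>i\<in>I. \<bar>g a i - g b i\<bar> < \<epsilon>"
proof -
  define h where "h a = (\<lambda>i\<in>I. \<lfloor>g a i / \<epsilon>\<rfloor>)" for a
  have "h ` A \<subseteq> I \<rightarrow>\<^sub>E {0..\<lfloor>1 / \<epsilon>\<rfloor>}"
    using g \<epsilon> by (auto simp: h_def intro!: floor_mono divide_right_mono)
  then have "finite (h ` A)"
    using finite_PiE[OF I, of "\<lambda>_. {0..\<lfloor>1 / \<epsilon>\<rfloor>}"] finite_subset by auto
  then obtain B where B: "B \<subseteq> A" "finite B" "h ` A = h ` B"
    using finite_subset_image[of "h ` A" h A] by auto
  have "\<exists>b\<in>B. \<forall>i\<in>I. \<bar>g a i - g b i\<bar> < \<epsilon>" if a: "a \<in> A" for a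
  proof -
    have "h a \<in> h ` B" using a B(3) by blast
    then obtain b where b: "b \<in> B" "h a = h b" by blast
    have "\<bar>g a i - g b i\<bar> < \<epsilon>" if "i \<in> I" for i
    proof -
      have "\<lfloor>g a i / \<epsilon>\<rfloor> = \<lfloor>g b i / \<epsilon>\<rfloor>"
        using fun_cong[OF b(2), of i] that by (simp add: h_def)
      then have "\<bar>g a i / \<epsilon> - g b i / \<epsilon>\<bar> < 1"
        by linarith
      also have "\<bar>g a i / \<epsilon> - g b i / \<epsilon>\<bar> = \<bar>g a i - g b i\<bar> / \<epsilon>"
        using \<epsilon> by (simp add: diff_divide_distrib[symmetric])
      finally show ?thesis using \<epsilon> by simp
    qed
    then show ?thesis using b(1) by blast
  qed
  then show thesis by (rule that[OF B(2,1)])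
qed

context Metric_space
begin

definition lip1 :: "('a \<Rightarrow> real) set" where
  "lip1 = {\<phi>. (\<forall>x\<in>M. 0 \<le> \<phi> x \<and> \<phi> x \<le> 1) \<and> (\<forall>x\<in>M. \<forall>y\<in>M. \<bar>\<phi> x - \<phi> y\<bar> \<le> d x y)}"

lemma lip1D:
  assumes "\<phi> \<in> lip1" "x \<in> M"
  shows "0 \<le> \<phi> x" "\<phi> x \<le> 1" "y \<in> M \<Longrightarrow> \<bar>\<phi> x - \<phi> y\<bar> \<le> d x y"
  using assms by (auto simp: lip1_def)

lemma lip1_nonempty: "lip1 \<noteq> {}"
proof -
  have "(\<lambda>_. 0) \<in> lip1" by (simp add: lip1_def)
  then show ?thesis by blast
qed

lemma lip1_continuous:
  assumes "\<phi> \<in> lip1"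
  shows "continuous_map mtopology euclideanreal \<phi>"
proof -
  have "Lipschitz_continuous_map Self euclidean_metric \<phi>"
    unfolding Lipschitz_continuous_map_def
    using lip1D[OF assms] by (auto simp: dist_real_def intro!: exI[of _ 1])
  then show ?thesis
    using Lipschitz_continuous_imp_continuous_map[of Self euclidean_metric \<phi>]
    by (simp add: mtopology_of_def)
qed

text \<open>
  The bump is \<open>r\<close> minus the distance to \<open>C\<close>, cut off at zero, where \<open>r\<close> is a Lebesgue number. Its
  height has to shrink with the distance from \<open>C\<close> to the complement of \<open>W\<close>, since the Lipschitz
  constant is one.
\<close>

lemma lip1_bump:
  assumes C: "compactin mtopology C" and W: "openin mtopology W" and CW: "C \<subseteq> W"
  obtains r \<phi> where "0 < r" "\<phi> \<in> lip1" "\<forall>x\<in>M. \<phi> x \<le> r" "\<forall>x\<in>C. \<phi> x = r" "\<forall>x\<in>M - W. \<phi> x = 0"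
proof -
  have "\<exists>\<epsilon>>0. \<forall>x\<in>C. \<exists>U\<in>{W}. mball x \<epsilon> \<subseteq> U"
    by (rule lebesgue_number[OF C]) (use CW W in auto)
  then obtain \<epsilon> where \<epsilon>: "\<epsilon> > 0" "\<And>x. x \<in> C \<Longrightarrow> mball x \<epsilon> \<subseteq> W" by auto
  define r where "r = min 1 \<epsilon>"
  have r: "0 < r" "r \<le> 1" "r \<le> \<epsilon>" using \<epsilon> by (auto simp: r_def)
  have CM: "C \<subseteq> M" using compactin_subset_topspace[OF C] by simp
  define V where "V x = insert 0 ((\<lambda>c. r - d c x) ` C)" for x
  define \<phi> where "\<phi> x = Sup (V x)" for x
  have V: "bdd_above (V x)" "\<And>v. v \<in> V x \<Longrightarrow> v \<le> r" for x
    using r by (auto simp: V_def intro!: bdd_aboveI[of _ r])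
  have le_r: "\<phi> x \<le> r" for x
    unfolding \<phi>_def by (rule cSup_least) (use V in \<open>auto simp: V_def\<close>)
  have ge0: "0 \<le> \<phi> x" for x
    unfolding \<phi>_def by (rule cSup_upper[OF _ V(1)]) (simp add: V_def)
  have ge: "r - d c x \<le> \<phi> x" if "c \<in> C" for c x
    unfolding \<phi>_def by (rule cSup_upper[OF _ V(1)]) (use that in \<open>simp add: V_def\<close>)
  have lip: "\<phi> x \<le> \<phi> y + d x y" if xy: "x \<in> M" "y \<in> M" for x y
    unfolding \<phi>_def[of x]
  proof (rule cSup_least)
    fix v assume "v \<in> V x"
    then consider "v = 0" | c where "c \<in> C" "v = r - d c x" by (auto simp: V_def)
    then show "v \<le> \<phi> y + d x y"
    proof cases
      case 1
      then show ?thesis using ge0[of y] by simp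
    next
      case 2
      have "d c y \<le> d c x + d x y" using triangle CM 2(1) xy by blast
      then show ?thesis using ge[OF 2(1), of y] 2(2) by linarith
    qed
  qed (simp add: V_def)
  have "\<phi> \<in> lip1"
    unfolding lip1_def
  proof (intro CollectI conjI ballI)
    fix x y assume xy: "x \<in> M" "y \<in> M"
    show "\<bar>\<phi> x - \<phi> y\<bar> \<le> d x y"
      using lip[OF xy] lip[OF xy(2,1)] commute[of x y] by linarith
  qed (use ge0 le_r r in \<open>auto intro: order_trans\<close>)
  moreover have "\<phi> x = r" if "x \<in> C" for x
    using ge[OF that, of x] le_r[of x] that CM by auto
  moreover have "\<phi> x = 0" if x: "x \<in> M - W" for x
  proof -
    have "d c x \<ge> \<epsilon>" if "c \<in> C" for c
      using \<epsilon>(2)[OF that] x CM that by (force simp: not_le)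
    then have "\<phi> x \<le> 0"
      unfolding \<phi>_def by (intro cSup_least) (use r in \<open>force simp: V_def\<close>)+
    then show ?thesis using ge0[of x] by simp
  qed
  ultimately show thesis
    using le_r by (intro that[OF r(1)]) auto
qed

text \<open>
  A 1-Lipschitz function is known up to \<open>\<epsilon>\<close> on \<open>S\<close> from its approximate values on a finite
  \<open>\<epsilon>/3\<close>-net of \<open>S\<close>.
\<close>

lemma lip1_finite_net:
  assumes S: "mtotally_bounded S" and \<epsilon>: "\<epsilon> > 0"
  obtains F where "finite F" "F \<subseteq> lip1" "\<And>\<phi>. \<phi> \<in> lip1 \<Longrightarrow> \<exists>\<psi>\<in>F. \<forall>x\<in>S. \<bar>\<phi> x - \<psi> x\<bar> < \<epsilon>"
proof -
  have "\<epsilon>/3 > 0" using \<epsilon> by simp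
  then obtain K where K: "finite K" "K \<subseteq> S" "S \<subseteq> (\<Union>x\<in>K. mball x (\<epsilon>/3))"
    using S unfolding mtotally_bounded_def by metis
  have KM: "K \<subseteq> M" using K(2) mtotally_bounded_imp_subset[OF S] by blast
  have rng: "0 \<le> \<phi> x \<and> \<phi> x \<le> 1" if "\<phi> \<in> lip1" "x \<in> K" for \<phi> x
    using that KM lip1D by blast
  obtain F where F: "finite F" "F \<subseteq> lip1"
      "\<And>\<phi>. \<phi> \<in> lip1 \<Longrightarrow> \<exists>\<psi>\<in>F. \<forall>x\<in>K. \<bar>\<phi> x - \<psi> x\<bar> < \<epsilon>/3"
    using finite_approximation[OF K(1) \<open>\<epsilon>/3 > 0\<close>, of lip1 "\<lambda>\<phi>. \<phi>"] rng by blast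
  have "\<exists>\<psi>\<in>F. \<forall>x\<in>S. \<bar>\<phi> x - \<psi> x\<bar> < \<epsilon>" if \<phi>: "\<phi> \<in> lip1" for \<phi>
  proof -
    obtain \<psi> where \<psi>: "\<psi> \<in> F" "\<And>x. x \<in> K \<Longrightarrow> \<bar>\<phi> x - \<psi> x\<bar> < \<epsilon>/3" using F(3)[OF \<phi>] by blast
    have "\<bar>\<phi> x - \<psi> x\<bar> < \<epsilon>" if x: "x \<in> S" for x
    proof -
      obtain k where k: "k \<in> K" "x \<in> mball k (\<epsilon>/3)" using K(3) x by blast
      then have "k \<in> M" "x \<in> M" "d k x < \<epsilon>/3" by auto
      moreover have "\<psi> \<in> lip1" using \<psi>(1) F(2) by blast
      ultimately show ?thesis
        using lip1D(3)[OF \<phi>, of k x] lip1D(3)[of \<psi> k x] \<psi>(2)[OF k(1)] by linarith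
    qed
    then show ?thesis using \<psi>(1) by blast
  qed
  then show thesis using that F(1,2) by blast
qed

definition functionals :: "(('a \<Rightarrow> real) \<Rightarrow> real) set" where
  "functionals = Met_TC.fspace lip1"

definition fun_dist :: "(('a \<Rightarrow> real) \<Rightarrow> real) \<Rightarrow> (('a \<Rightarrow> real) \<Rightarrow> real) \<Rightarrow> real" where
  "fun_dist = Met_TC.fdist lip1"

lemma Metric_space_functionals: "Metric_space functionals fun_dist"
  unfolding functionals_def fun_dist_def by (rule Met_TC.Metric_space_funspace)

lemma mcomplete_functionals: "Metric_space.mcomplete functionals fun_dist"
proof -
  have "mcomplete_of (funspace lip1 (Met_TC.Self :: real metric))"
    by (rule Met_TC.mcomplete_funspace) (simp add: complete_UNIV)
  then show ?thesis
    by (simp add: mcomplete_of_def functionals_def fun_dist_def)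
qed

lemma restrict_in_functionals:
  assumes "\<And>\<phi>. \<phi> \<in> lip1 \<Longrightarrow> 0 \<le> F \<phi> \<and> F \<phi> \<le> 1"
  shows "restrict F lip1 \<in> functionals"
proof -
  have "restrict F lip1 ` lip1 \<subseteq> {0..1}" using assms by auto
  then have "bounded (restrict F lip1 ` lip1)"
    using bounded_subset bounded_closed_interval by blast
  then show ?thesis
    unfolding functionals_def Met_TC.fspace_def by auto
qed

lemma fun_dist_le_iff:
  assumes "\<Phi> \<in> functionals" "\<Psi> \<in> functionals"
  shows "fun_dist \<Phi> \<Psi> \<le> a \<longleftrightarrow> (\<forall>\<phi>\<in>lip1. \<bar>\<Phi> \<phi> - \<Psi> \<phi>\<bar> \<le> a)"
  using Met_TC.funspace_mdist_le[of \<Phi> lip1 \<Psi> a] assms lip1_nonempty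
  unfolding functionals_def fun_dist_def dist_real_def by blast

lemma fun_dist_ge:
  assumes "\<Phi> \<in> functionals" "\<Psi> \<in> functionals" "\<phi> \<in> lip1"
  shows "\<bar>\<Phi> \<phi> - \<Psi> \<phi>\<bar> \<le> fun_dist \<Phi> \<Psi>"
  using fun_dist_le_iff[OF assms(1,2), of "fun_dist \<Phi> \<Psi>"] assms(3) by blast

lemma functionals_limit:
  assumes lim: "limitin (Metric_space.mtopology functionals fun_dist) \<sigma> \<Phi> F" and \<phi>: "\<phi> \<in> lip1"
  shows "((\<lambda>n. \<sigma> n \<phi>) \<longlongrightarrow> \<Phi> \<phi>) F"
proof -
  interpret F: Metric_space functionals fun_dist by (rule Metric_space_functionals)
  show ?thesis
  proof (rule tendstoI)
    fix e :: real assume "e > 0"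
    then have "\<Phi> \<in> functionals" "\<forall>\<^sub>F n in F. \<sigma> n \<in> functionals \<and> fun_dist (\<sigma> n) \<Phi> < e"
      using lim unfolding F.limitin_metric by auto
    from this(2) show "\<forall>\<^sub>F n in F. dist (\<sigma> n \<phi>) (\<Phi> \<phi>) < e"
      by eventually_elim
        (use fun_dist_ge[OF _ \<open>\<Phi> \<in> functionals\<close> \<phi>] in \<open>force simp: dist_real_def\<close>)
  qed
qed

text \<open>
  The hypothesis \<open>tight\<close> says that, up to a small error, the functionals only see the values on a
  totally bounded set. So their values on a finite net of \<open>lip1\<close> determine them approximately,
  the range of the sequence is totally bounded, and completeness yields a limit.
\<close>

lemma tight_functionals_convergent_subsequence:
  fixes \<sigma> :: "nat \<Rightarrow> ('a \<Rightarrow> real) \<Rightarrow> real"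
  assumes \<sigma>: "\<And>n. \<sigma> n \<in> functionals" and rng: "\<And>n \<phi>. \<phi> \<in> lip1 \<Longrightarrow> 0 \<le> \<sigma> n \<phi> \<and> \<sigma> n \<phi> \<le> 1"
    and tight: "\<And>\<epsilon>. \<epsilon> > 0 \<Longrightarrow> \<exists>S. mtotally_bounded S \<and> (\<forall>n. \<forall>\<phi>\<in>lip1. \<forall>\<psi>\<in>lip1.
      (\<forall>x\<in>S. \<bar>\<phi> x - \<psi> x\<bar> < \<epsilon>) \<longrightarrow> \<bar>\<sigma> n \<phi> - \<sigma> n \<psi>\<bar> \<le> 2 * \<epsilon>)"
  obtains \<Phi> r where "strict_mono r"
    "limitin (Metric_space.mtopology functionals fun_dist) (\<sigma> \<circ> r) \<Phi> sequentially"
proof -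
  interpret F: Metric_space functionals fun_dist by (rule Metric_space_functionals)
  have "F.mtotally_bounded (range \<sigma>)"
    unfolding F.mtotally_bounded_def
  proof (intro allI impI)
    fix e :: real assume "e > 0"
    \<comment> \<open>Two steps to the net, each of size \<open>2 * (e/6)\<close>, and one of size \<open>e/6\<close> between the values on the net.\<close>
    then have \<epsilon>: "e/6 > 0" by simp
    obtain S where S: "mtotally_bounded S" and close: "\<And>n \<phi> \<psi>. \<lbrakk>\<phi> \<in> lip1; \<psi> \<in> lip1;
        \<forall>x\<in>S. \<bar>\<phi> x - \<psi> x\<bar> < e/6\<rbrakk> \<Longrightarrow> \<bar>\<sigma> n \<phi> - \<sigma> n \<psi>\<bar> \<le> 2 * (e/6)"
      using tight[OF \<epsilon>] by blast
    obtain K where K: "finite K" "K \<subseteq> lip1"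
        "\<And>\<phi>. \<phi> \<in> lip1 \<Longrightarrow> \<exists>\<psi>\<in>K. \<forall>x\<in>S. \<bar>\<phi> x - \<psi> x\<bar> < e/6"
      using lip1_finite_net[OF S \<epsilon>] by blast
    have "0 \<le> \<sigma> n \<psi> \<and> \<sigma> n \<psi> \<le> 1" if "\<psi> \<in> K" for n \<psi>
      using rng K(2) that by blast
    then obtain B where B: "finite B" "\<And>n. \<exists>b\<in>B. \<forall>\<psi>\<in>K. \<bar>\<sigma> n \<psi> - \<sigma> b \<psi>\<bar> < e/6"
      using finite_approximation[OF K(1) \<epsilon>, of UNIV \<sigma>] by (metis UNIV_I)
    have "\<exists>b\<in>B. \<sigma> n \<in> F.mball (\<sigma> b) e" for n
    proof -
      obtain b where b: "b \<in> B" "\<And>\<psi>. \<psi> \<in> K \<Longrightarrow> \<bar>\<sigma> n \<psi> - \<sigma> b \<psi>\<bar> < e/6"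
        using B(2) by blast
      have "\<bar>\<sigma> b \<phi> - \<sigma> n \<phi>\<bar> \<le> 5 * (e/6)" if \<phi>: "\<phi> \<in> lip1" for \<phi>
      proof -
        obtain \<psi> where \<psi>: "\<psi> \<in> K" "\<forall>x\<in>S. \<bar>\<phi> x - \<psi> x\<bar> < e/6" using K(3)[OF \<phi>] by blast
        then have "\<bar>\<sigma> n \<phi> - \<sigma> n \<psi>\<bar> \<le> 2 * (e/6)" "\<bar>\<sigma> b \<phi> - \<sigma> b \<psi>\<bar> \<le> 2 * (e/6)"
          using close[OF \<phi>, of \<psi>] K(2) by blast+
        then show ?thesis using b(2)[OF \<psi>(1)] by linarith
      qed
      then have "fun_dist (\<sigma> b) (\<sigma> n) \<le> 5 * (e/6)"
        using fun_dist_le_iff[OF \<sigma> \<sigma>] by blast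
      then show ?thesis using b(1) \<sigma> \<open>e > 0\<close> by (intro bexI[of _ b]) auto
    qed
    then show "\<exists>K. finite K \<and> K \<subseteq> range \<sigma> \<and> range \<sigma> \<subseteq> (\<Union>x\<in>K. F.mball x e)"
      using B(1) by (intro exI[of _ "\<sigma> ` B"]) auto
  qed
  then obtain r where r: "strict_mono r" "F.MCauchy (\<sigma> \<circ> r)"
    unfolding F.mtotally_bounded_sequentially by blast
  then show thesis
    using that mcomplete_functionals unfolding F.mcomplete_def by blast
qed

end

section \<open>Sequential compactness of compact sets of measures\<close>

lemma card_fractions_below:
  fixes t :: real
  assumes "0 \<le> t" "t \<le> 1" "0 < N"
  shows "real (card {i\<in>{1..N}. real i / real N < t}) \<le> N * t"
    "N * t \<le> real (card {i\<in>{1..N}. real i / real N < t}) + 1"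
proof -
  \<comment> \<open>The number of positive integers strictly below \<open>N * t\<close>.\<close>
  define m where "m = nat (\<lceil>N * t\<rceil> - 1)"
  have "{i\<in>{1..N}. real i / real N < t} = {1..m}"
  proof (intro set_eqI iffI)
    fix i assume "i \<in> {i\<in>{1..N}. real i / real N < t}"
    then have "1 \<le> i" "real i < N * t" using assms(3) by (auto simp: field_simps)
    then have "int i < \<lceil>N * t\<rceil>" by (simp add: less_ceiling_iff)
    then show "i \<in> {1..m}" using \<open>1 \<le> i\<close> by (auto simp: m_def)
  next
    fix i assume "i \<in> {1..m}"
    then have "1 \<le> i" "int i < \<lceil>N * t\<rceil>" by (auto simp: m_def)
    then have i: "real i < N * t" using less_ceiling_iff[of "int i" "N * t"] by simp
    moreover have "N * t \<le> N" using assms by (simp add: mult_left_le)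
    ultimately have "i \<le> N" "real i < N * t" by linarith+
    then show "i \<in> {i\<in>{1..N}. real i / real N < t}"
      using \<open>1 \<le> i\<close> assms(3) by (auto simp: field_simps)
  qed
  then have "card {i\<in>{1..N}. real i / real N < t} = m" by simp
  moreover have "real m \<le> N * t"
  proof (cases "\<lceil>N * t\<rceil> \<le> 1")
    case True
    then show ?thesis using assms by (simp add: m_def)
  next
    case False
    then have "real m = of_int \<lceil>N * t\<rceil> - 1" by (simp add: m_def)
    then show ?thesis using ceiling_correct[of "N * t"] by linarith
  qed
  moreover have "N * t \<le> real m + 1"
    using ceiling_correct[of "N * t"] by (simp add: m_def) linarith
  ultimately show "real (card {i\<in>{1..N}. real i / real N < t}) \<le> N * t"
    "N * t \<le> real (card {i\<in>{1..N}. real i / real N < t}) + 1" by simp_all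
qed

lemma continuous_measurable_radon:
  assumes \<mu>: "\<mu> \<in> radon_probs X" and \<psi>: "continuous_map X euclideanreal \<psi>"
  shows "\<psi> \<in> borel_measurable \<mu>"
proof (rule borel_measurableI)
  fix S :: "real set" assume "open S"
  then have "openin X {x \<in> topspace X. \<psi> x \<in> S}"
    using openin_continuous_map_preimage[OF \<psi>] by simp
  moreover have "\<psi> -` S \<inter> space \<mu> = {x \<in> topspace X. \<psi> x \<in> S}"
    using radon_probsD(3)[OF \<mu>] by auto
  ultimately show "\<psi> -` S \<inter> space \<mu> \<in> sets \<mu>"
    using open_in_sets_radon[OF \<mu>] by simp
qed

lemma integrable_radon:
  assumes \<mu>: "\<mu> \<in> radon_probs X" and \<psi>: "continuous_map X euclideanreal \<psi>"
    and rng: "\<And>x. x \<in> topspace X \<Longrightarrow> 0 \<le> \<psi> x \<and> \<psi> x \<le> 1"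
  shows "integrable \<mu> \<psi>"
proof -
  interpret prob_space \<mu> using radon_probsD(1)[OF \<mu>] .
  show ?thesis
    by (rule integrable_const_bound[of _ 1])
      (use rng radon_probsD(3)[OF \<mu>] continuous_measurable_radon[OF \<mu> \<psi>] in auto)
qed

text \<open>
  Integrate the pointwise estimate of \<open>\<psi>\<close> by the proportion of the levels \<open>i / N\<close> that lie below
  it.
\<close>

lemma integral_step_approx:
  assumes \<mu>: "\<mu> \<in> radon_probs X" and \<psi>: "continuous_map X euclideanreal \<psi>"
    and rng: "\<And>x. x \<in> topspace X \<Longrightarrow> 0 \<le> \<psi> x \<and> \<psi> x \<le> 1" and N: "0 < N"
  defines "S \<equiv> (\<Sum>i=1..N. measure \<mu> {x \<in> topspace X. real i / real N < \<psi> x}) / real N"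
  shows "S \<le> integral\<^sup>L \<mu> \<psi>" "integral\<^sup>L \<mu> \<psi> \<le> S + 1 / real N"
proof -
  interpret prob_space \<mu> using radon_probsD(1)[OF \<mu>] .
  let ?A = "\<lambda>i. {x \<in> topspace X. real i / real N < \<psi> x}"
  have "openin X {x \<in> topspace X. \<psi> x \<in> {real i / real N<..}}" for i
    by (rule openin_continuous_map_preimage[OF \<psi>]) simp
  then have A: "?A i \<in> sets \<mu>" for i
    using open_in_sets_radon[OF \<mu>] by simp
  define h where "h x = (\<Sum>i=1..N. indicator (?A i) x) / real N" for x
  have int_h: "integrable \<mu> h"
    unfolding h_def using A by (simp add: emeasure_eq_measure)
  have S: "integral\<^sup>L \<mu> h = S"
    unfolding h_def S_def using A by (simp add: emeasure_eq_measure)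
  have h: "h x \<le> \<psi> x" "\<psi> x \<le> h x + 1 / real N" if x: "x \<in> topspace X" for x
  proof -
    have "(\<Sum>i=1..N. indicator (?A i) x) = (\<Sum>i\<in>{1..N}. if real i / real N < \<psi> x then 1 else (0::real))"
      using x by (intro sum.cong) (auto simp: indicator_def)
    also have "\<dots> = real (card {i\<in>{1..N}. real i / real N < \<psi> x})"
      by (simp add: sum.inter_filter[symmetric])
    finally have "N * h x = real (card {i\<in>{1..N}. real i / real N < \<psi> x})"
      using N by (simp add: h_def)
    then have "N * h x \<le> N * \<psi> x" "N * \<psi> x \<le> N * h x + 1"
      using card_fractions_below[of "\<psi> x" N] rng[OF x] N by linarith+
    then show "h x \<le> \<psi> x" "\<psi> x \<le> h x + 1 / real N"
      using N by (simp_all add: field_simps)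
  qed
  have \<psi>i: "integrable \<mu> \<psi>" by (rule integrable_radon[OF \<mu> \<psi> rng])
  show "S \<le> integral\<^sup>L \<mu> \<psi>"
    unfolding S[symmetric] by (rule integral_mono[OF int_h \<psi>i]) (use h radon_probsD(3)[OF \<mu>] in simp)
  have "integral\<^sup>L \<mu> \<psi> \<le> (\<integral>x. h x + 1 / real N \<partial>\<mu>)"
    by (rule integral_mono) (use int_h \<psi>i h radon_probsD(3)[OF \<mu>] in simp_all)
  also have "\<dots> = S + 1 / real N"
    using int_h S by (simp add: prob_space)
  finally show "integral\<^sup>L \<mu> \<psi> \<le> S + 1 / real N" .
qed

text \<open>
  The integral is approximated, uniformly in the measure, by a finite sum of measures of open
  sets, and each of these is lower semicontinuous.
\<close>

lemma openin_integral_greater: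
  assumes \<psi>: "continuous_map X euclideanreal \<psi>"
    and rng: "\<And>x. x \<in> topspace X \<Longrightarrow> 0 \<le> \<psi> x \<and> \<psi> x \<le> 1"
  shows "openin (radon_prob_space X) {\<mu> \<in> radon_probs X. a < integral\<^sup>L \<mu> \<psi>}"
proof (subst openin_subopen, intro ballI)
  fix \<mu> assume "\<mu> \<in> {\<mu> \<in> radon_probs X. a < integral\<^sup>L \<mu> \<psi>}"
  then have \<mu>: "\<mu> \<in> radon_probs X" "a < integral\<^sup>L \<mu> \<psi>" by auto
  \<comment> \<open>Half of the slack is spent on the step approximation, half on moving the measure.\<close>
  define \<eta> where "\<eta> = (integral\<^sup>L \<mu> \<psi> - a) / 2"
  have \<eta>: "\<eta> > 0" using \<mu>(2) by (simp add: \<eta>_def)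
  obtain n where n: "1 / real (Suc n) < \<eta>"
    using nat_approx_posE[OF \<eta>] by blast
  define N where "N = Suc n"
  have N: "0 < N" "1 / real N < \<eta>" using n by (auto simp: N_def)
  let ?A = "\<lambda>i. {x \<in> topspace X. real i / real N < \<psi> x}"
  let ?S = "\<lambda>\<kappa>. (\<Sum>i=1..N. measure \<kappa> (?A i)) / real N"
  let ?W = "\<Inter>i\<in>{1..N}. {\<kappa> \<in> radon_probs X. measure \<mu> (?A i) - \<eta> < measure \<kappa> (?A i)}"
  have A: "openin X (?A i)" for i
  proof -
    have "openin X {x \<in> topspace X. \<psi> x \<in> {real i / real N<..}}"
      by (rule openin_continuous_map_preimage[OF \<psi>]) simp
    then show ?thesis by simp
  qed
  have "openin (radon_prob_space X) ?W"
    using N openin_measure_greater[OF A] by (intro openin_Inter) auto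
  moreover have "\<mu> \<in> ?W" using \<mu>(1) \<eta> by simp
  moreover have "?W \<subseteq> {\<mu> \<in> radon_probs X. a < integral\<^sup>L \<mu> \<psi>}"
  proof
    fix \<kappa> assume \<kappa>: "\<kappa> \<in> ?W"
    have "1 \<in> {1..N}" using N(1) by simp
    then have \<kappa>r: "\<kappa> \<in> radon_probs X" using \<kappa> by blast
    have "(\<Sum>i=1..N. measure \<mu> (?A i) - \<eta>) \<le> (\<Sum>i=1..N. measure \<kappa> (?A i))"
      using \<kappa> by (intro sum_mono) (auto intro: less_imp_le)
    then have "(\<Sum>i=1..N. measure \<mu> (?A i)) - N * \<eta> \<le> (\<Sum>i=1..N. measure \<kappa> (?A i))"
      by (simp add: sum_subtractf)
    then have "((\<Sum>i=1..N. measure \<mu> (?A i)) - N * \<eta>) / real N \<le> ?S \<kappa>"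
      by (rule divide_right_mono) simp
    then have "?S \<mu> - \<eta> \<le> ?S \<kappa>"
      using N(1) by (simp add: diff_divide_distrib)
    moreover have "integral\<^sup>L \<mu> \<psi> \<le> ?S \<mu> + 1 / real N" "?S \<kappa> \<le> integral\<^sup>L \<kappa> \<psi>"
      using integral_step_approx(2)[OF \<mu>(1) \<psi> rng N(1)]
        integral_step_approx(1)[OF \<kappa>r \<psi> rng N(1)] by simp_all
    moreover have "integral\<^sup>L \<mu> \<psi> - 2 * \<eta> = a" by (simp add: \<eta>_def field_simps)
    ultimately have "a < integral\<^sup>L \<kappa> \<psi>" using N(2) by linarith
    then show "\<kappa> \<in> {\<mu> \<in> radon_probs X. a < integral\<^sup>L \<mu> \<psi>}" using \<kappa>r by simp
  qed
  ultimately show "\<exists>T. openin (radon_prob_space X) T \<and> \<mu> \<in> T \<and> T \<subseteq> {\<mu> \<in> radon_probs X. a < integral\<^sup>L \<mu> \<psi>}"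
    by (intro exI conjI)
qed

lemma openin_integral_less:
  assumes \<psi>: "continuous_map X euclideanreal \<psi>"
    and rng: "\<And>x. x \<in> topspace X \<Longrightarrow> 0 \<le> \<psi> x \<and> \<psi> x \<le> 1"
  shows "openin (radon_prob_space X) {\<mu> \<in> radon_probs X. integral\<^sup>L \<mu> \<psi> < a}"
proof -
  let ?\<psi> = "\<lambda>x. 1 - \<psi> x"
  have "integral\<^sup>L \<mu> ?\<psi> = 1 - integral\<^sup>L \<mu> \<psi>" if \<mu>: "\<mu> \<in> radon_probs X" for \<mu>
  proof -
    interpret prob_space \<mu> using radon_probsD(1)[OF \<mu>] .
    show ?thesis using integrable_radon[OF \<mu> \<psi> rng] by (simp add: prob_space)
  qed
  then have "{\<mu> \<in> radon_probs X. integral\<^sup>L \<mu> \<psi> < a} = {\<mu> \<in> radon_probs X. 1 - a < integral\<^sup>L \<mu> ?\<psi>}"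
    by auto
  moreover have "continuous_map X euclideanreal ?\<psi>"
    using \<psi> by (intro continuous_map_diff) auto
  ultimately show ?thesis
    using openin_integral_greater[of X ?\<psi> "1 - a"] rng by simp
qed

lemma integral_diff_bound:
  assumes \<mu>: "\<mu> \<in> radon_probs X" and V: "openin X V"
    and \<phi>: "continuous_map X euclideanreal \<phi>" "\<And>x. x \<in> topspace X \<Longrightarrow> 0 \<le> \<phi> x \<and> \<phi> x \<le> 1"
    and \<psi>: "continuous_map X euclideanreal \<psi>" "\<And>x. x \<in> topspace X \<Longrightarrow> 0 \<le> \<psi> x \<and> \<psi> x \<le> 1"
    and le: "\<And>x. x \<in> V \<Longrightarrow> \<bar>\<phi> x - \<psi> x\<bar> \<le> \<delta>" and \<delta>: "0 \<le> \<delta>"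
  shows "\<bar>integral\<^sup>L \<mu> \<phi> - integral\<^sup>L \<mu> \<psi>\<bar> \<le> \<delta> + (1 - measure \<mu> V)"
proof -
  interpret prob_space \<mu> using radon_probsD(1)[OF \<mu>] .
  have i: "integrable \<mu> \<phi>" "integrable \<mu> \<psi>"
    using integrable_radon[OF \<mu>] \<phi> \<psi> by auto
  let ?T = "topspace X - V"
  have VT: "V \<in> sets \<mu>" "?T \<in> sets \<mu>"
    using open_in_sets_radon[OF \<mu>] V by auto
  have "\<bar>integral\<^sup>L \<mu> \<phi> - integral\<^sup>L \<mu> \<psi>\<bar> = \<bar>\<integral>x. \<phi> x - \<psi> x \<partial>\<mu>\<bar>"
    using i by simp
  also have "\<dots> \<le> (\<integral>x. \<bar>\<phi> x - \<psi> x\<bar> \<partial>\<mu>)"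
    by (rule integral_abs_bound)
  also have "\<dots> \<le> (\<integral>x. \<delta> + indicator ?T x \<partial>\<mu>)"
  proof (rule integral_mono)
    show "integrable \<mu> (\<lambda>x. \<bar>\<phi> x - \<psi> x\<bar>)" using i by simp
    show "integrable \<mu> (\<lambda>x. \<delta> + indicator ?T x)" using VT by (simp add: emeasure_eq_measure)
    fix x assume "x \<in> space \<mu>"
    then have x: "x \<in> topspace X" using radon_probsD(3)[OF \<mu>] by simp
    show "\<bar>\<phi> x - \<psi> x\<bar> \<le> \<delta> + indicator ?T x"
    proof (cases "x \<in> V")
      case True
      then show ?thesis using le by simp
    next
      case False
      then show ?thesis using \<phi>(2)[OF x] \<psi>(2)[OF x] \<delta> x by (simp add: abs_le_iff)
    qed
  qed
  also have "\<dots> = \<delta> + measure \<mu> ?T"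
    using VT by (simp add: emeasure_eq_measure prob_space)
  also have "measure \<mu> ?T = 1 - measure \<mu> V"
    by (rule measure_compl_radon[OF \<mu> VT(1)])
  finally show ?thesis .
qed

context Metric_space
begin

definition lip1_integral :: "('b \<Rightarrow> 'a) \<Rightarrow> 'b measure \<Rightarrow> ('a \<Rightarrow> real) \<Rightarrow> real" where
  "lip1_integral g \<mu> = (\<lambda>\<phi>\<in>lip1. \<integral>x. \<phi> (g x) \<partial>\<mu>)"

lemma lip1_compose:
  assumes g: "continuous_map X mtopology g" and \<phi>: "\<phi> \<in> lip1"
  shows "continuous_map X euclideanreal (\<lambda>x. \<phi> (g x))"
    "x \<in> topspace X \<Longrightarrow> 0 \<le> \<phi> (g x) \<and> \<phi> (g x) \<le> 1"
proof -
  show "continuous_map X euclideanreal (\<lambda>x. \<phi> (g x))"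
    using continuous_map_compose[OF g lip1_continuous[OF \<phi>]] by (simp add: comp_def)
  assume "x \<in> topspace X"
  then have "g x \<in> M" using g by (auto simp: continuous_map_def)
  then show "0 \<le> \<phi> (g x) \<and> \<phi> (g x) \<le> 1" using lip1D[OF \<phi>] by blast
qed

lemma lip1_integral_in_functionals:
  assumes g: "continuous_map X mtopology g" and \<mu>: "\<mu> \<in> radon_probs X"
  shows "lip1_integral g \<mu> \<in> functionals"
  unfolding lip1_integral_def
proof (rule restrict_in_functionals)
  fix \<phi> assume \<phi>: "\<phi> \<in> lip1"
  interpret prob_space \<mu> using radon_probsD(1)[OF \<mu>] .
  have rng: "\<And>x. x \<in> space \<mu> \<Longrightarrow> 0 \<le> \<phi> (g x) \<and> \<phi> (g x) \<le> 1"
    using lip1_compose(2)[OF g \<phi>] radon_probsD(3)[OF \<mu>] by simp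
  have "integrable \<mu> (\<lambda>x. \<phi> (g x))"
    using integrable_radon[OF \<mu>] lip1_compose[OF g \<phi>] by blast
  then have "(\<integral>x. \<phi> (g x) \<partial>\<mu>) \<le> (\<integral>x. 1 \<partial>\<mu>)"
    using rng by (intro integral_mono) auto
  then show "0 \<le> (\<integral>x. \<phi> (g x) \<partial>\<mu>) \<and> (\<integral>x. \<phi> (g x) \<partial>\<mu>) \<le> 1"
    using rng by (auto simp: prob_space intro: Bochner_Integration.integral_nonneg)
qed

text \<open>
  The continuity is uniform over all \<open>\<phi>\<close> in \<open>lip1\<close>. A compact set \<open>K\<close> carries almost all of \<open>\<mu>\<close>,
  and its neighbourhood \<open>V\<close> carries almost all of each nearby measure; on \<open>V\<close> every \<open>\<phi>\<close> is close
  to one of finitely many members of \<open>lip1\<close>.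
\<close>

lemma continuous_lip1_integral:
  assumes g: "continuous_map X mtopology g" and H: "Hausdorff_space X"
  shows "continuous_map (radon_prob_space X) (Metric_space.mtopology functionals fun_dist)
    (lip1_integral g)"
proof -
  interpret F: Metric_space functionals fun_dist by (rule Metric_space_functionals)
  show ?thesis
    unfolding F.continuous_map_to_metric
  proof (intro ballI allI impI)
    fix \<mu> and e :: real assume "\<mu> \<in> topspace (radon_prob_space X)" and "e > 0"
    then have \<mu>: "\<mu> \<in> radon_probs X" by (simp add: topspace_radon_prob_space)
    \<comment> \<open>The final estimate adds up to \<open>9 * \<epsilon>\<close>.\<close>
    define \<epsilon> where "\<epsilon> = e / 12"
    have \<epsilon>: "\<epsilon> > 0" using \<open>e > 0\<close> by (simp add: \<epsilon>_def)
    have "1 - \<epsilon> < measure \<mu> (topspace X)"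
      using \<epsilon> prob_space.prob_space[OF radon_probsD(1)[OF \<mu>]] radon_probsD(3)[OF \<mu>] by simp
    then obtain K where K: "compactin X K" "1 - \<epsilon> < measure \<mu> K"
      using radon_inner_compact[OF \<mu> H open_in_sets_radon[OF \<mu> openin_topspace]] by metis
    have gK: "compactin mtopology (g ` K)"
      using image_compactin[OF K(1) g] .
    have KX: "K \<subseteq> topspace X" and gKM: "g ` K \<subseteq> M"
      using compactin_subset_topspace[OF K(1)] compactin_subset_topspace[OF gK] by auto
    obtain B where B: "finite B" "B \<subseteq> lip1" "\<And>\<phi>. \<phi> \<in> lip1 \<Longrightarrow> \<exists>\<psi>\<in>B. \<forall>y\<in>g ` K. \<bar>\<phi> y - \<psi> y\<bar> < \<epsilon>"
      using lip1_finite_net[OF compactin_imp_mtotally_bounded[OF gK] \<epsilon>] by metis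
    define V where "V = {x \<in> topspace X. g x \<in> (\<Union>y\<in>g ` K. mball y \<epsilon>)}"
    have V: "openin X V"
      unfolding V_def by (rule openin_continuous_map_preimage[OF g]) auto
    have KV: "K \<subseteq> V"
    proof
      fix x assume x: "x \<in> K"
      then have "g x \<in> mball (g x) \<epsilon>" using gKM \<epsilon> by auto
      then show "x \<in> V" using x KX unfolding V_def by blast
    qed
    have \<mu>V: "1 - \<epsilon> < measure \<mu> V"
      using K(2) measure_mono_radon[OF \<mu> open_in_sets_radon[OF \<mu> V] KV] by simp
    let ?I = "\<lambda>\<nu> \<psi>. \<integral>x. \<psi> (g x) \<partial>\<nu>"
    let ?N = "\<lambda>\<psi>. {\<nu> \<in> radon_probs X. ?I \<mu> \<psi> - \<epsilon> < ?I \<nu> \<psi>} \<inter> {\<nu> \<in> radon_probs X. ?I \<nu> \<psi> < ?I \<mu> \<psi> + \<epsilon>}"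
    define W where "W = \<Inter>(insert {\<nu> \<in> radon_probs X. 1 - \<epsilon> < measure \<nu> V} (?N ` B))"
    have "openin (radon_prob_space X) (?N \<psi>)" if "\<psi> \<in> B" for \<psi>
    proof -
      have "\<psi> \<in> lip1" using that B(2) by blast
      note l = lip1_compose[OF g this]
      show ?thesis
        using openin_integral_greater[OF l] openin_integral_less[OF l] by blast
    qed
    then have "openin (radon_prob_space X) W"
      unfolding W_def using B(1) openin_measure_greater[OF V] by (intro openin_Inter) auto
    moreover have "\<mu> \<in> W" using \<mu> \<mu>V \<epsilon> by (simp add: W_def)
    moreover have "lip1_integral g \<nu> \<in> F.mball (lip1_integral g \<mu>) e" if \<nu>W: "\<nu> \<in> W" for \<nu>
    proof -
      have \<nu>: "\<nu> \<in> radon_probs X" and \<nu>V: "1 - \<epsilon> < measure \<nu> V"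
        and near: "\<And>\<psi>. \<psi> \<in> B \<Longrightarrow> \<bar>?I \<nu> \<psi> - ?I \<mu> \<psi>\<bar> < \<epsilon>"
        using \<nu>W by (auto simp: W_def)
      have "\<bar>?I \<mu> \<phi> - ?I \<nu> \<phi>\<bar> \<le> 9 * \<epsilon>" if \<phi>: "\<phi> \<in> lip1" for \<phi>
      proof -
        obtain \<psi> where \<psi>: "\<psi> \<in> B" "\<And>y. y \<in> g ` K \<Longrightarrow> \<bar>\<phi> y - \<psi> y\<bar> < \<epsilon>"
          using B(3)[OF \<phi>] by blast
        have \<psi>l: "\<psi> \<in> lip1" using \<psi>(1) B(2) by blast
        have cl: "\<bar>\<phi> (g x) - \<psi> (g x)\<bar> \<le> 3 * \<epsilon>" if xV: "x \<in> V" for x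
        proof -
          obtain y where y: "y \<in> g ` K" "g x \<in> mball y \<epsilon>"
            using xV unfolding V_def by blast
          then have "y \<in> M" "g x \<in> M" "d y (g x) < \<epsilon>" by auto
          then show ?thesis
            using lip1D(3)[OF \<phi>, of y "g x"] lip1D(3)[OF \<psi>l, of y "g x"] \<psi>(2)[OF y(1)] by linarith
        qed
        have diff: "\<bar>?I \<kappa> \<phi> - ?I \<kappa> \<psi>\<bar> \<le> 3 * \<epsilon> + (1 - measure \<kappa> V)" if \<kappa>: "\<kappa> \<in> radon_probs X" for \<kappa>
          by (rule integral_diff_bound[OF \<kappa> V lip1_compose[OF g \<phi>] lip1_compose[OF g \<psi>l] cl])
            (use \<epsilon> in auto)
        show ?thesis
          using diff[OF \<mu>] diff[OF \<nu>] near[OF \<psi>(1)] \<mu>V \<nu>V by linarith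
      qed
      then have "fun_dist (lip1_integral g \<mu>) (lip1_integral g \<nu>) \<le> 9 * \<epsilon>"
        using fun_dist_le_iff[OF lip1_integral_in_functionals[OF g \<mu>] lip1_integral_in_functionals[OF g \<nu>]]
        by (simp add: lip1_integral_def)
      then show ?thesis
        using lip1_integral_in_functionals[OF g \<mu>] lip1_integral_in_functionals[OF g \<nu>] \<open>e > 0\<close>
        by (simp add: \<epsilon>_def)
    qed
    ultimately show "\<exists>U. openin (radon_prob_space X) U \<and> \<mu> \<in> U \<and>
        (\<forall>\<nu>\<in>U. lip1_integral g \<nu> \<in> F.mball (lip1_integral g \<mu>) e)"
      by (intro exI[of _ W]) simp
  qed
qed

text \<open>
  By injectivity of \<open>g\<close>, the images of a compact \<open>K\<close> and of a compact \<open>L\<close> disjoint from \<open>K\<close> are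
  disjoint, and a bump separates them. Here \<open>L\<close> exhausts the complement of \<open>K\<close> up to \<open>e\<close> for the
  second measure.
\<close>

lemma inj_lip1_integral:
  assumes g: "continuous_map X mtopology g" and inj: "inj_on g (topspace X)" and H: "Hausdorff_space X"
  shows "inj_on (lip1_integral g) (radon_probs X)"
proof (rule inj_onI)
  have le: "measure \<mu> K \<le> measure \<nu> K"
    if \<mu>: "\<mu> \<in> radon_probs X" and \<nu>: "\<nu> \<in> radon_probs X" and K: "compactin X K"
      and eq: "lip1_integral g \<mu> = lip1_integral g \<nu>" for \<mu> \<nu> K
  proof (rule field_le_epsilon)
    fix e :: real assume e: "e > 0"
    interpret \<mu>: prob_space \<mu> using radon_probsD(1)[OF \<mu>] .
    interpret \<nu>: prob_space \<nu> using radon_probsD(1)[OF \<nu>] .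
    have Ks: "K \<in> sets \<mu>" "K \<in> sets \<nu>"
      using compact_in_sets_radon[OF \<mu> H K] compact_in_sets_radon[OF \<nu> H K] .
    have KX: "K \<subseteq> topspace X" using compactin_subset_topspace[OF K] .
    have T: "topspace X - K \<in> sets \<nu>"
      using open_in_sets_radon[OF \<nu>] compactin_imp_closedin[OF H K] by (simp add: closedin_def)
    have "measure \<nu> (topspace X - K) - e < measure \<nu> (topspace X - K)" using e by simp
    then obtain L where L: "compactin X L" "L \<subseteq> topspace X - K"
        "measure \<nu> (topspace X - K) - e < measure \<nu> L"
      using radon_inner_compact[OF \<nu> H T] by metis
    have gL: "closedin mtopology (g ` L)"
      using compactin_imp_closedin[OF Hausdorff_space_mtopology image_compactin[OF L(1) g]] .
    have gK: "compactin mtopology (g ` K)" using image_compactin[OF K g] .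
    have "openin mtopology (M - g ` L)" using gL by (simp add: closedin_def)
    moreover have "g ` K \<subseteq> M - g ` L"
    proof -
      have "g ` K \<inter> g ` L = g ` (K \<inter> L)"
        using inj_on_image_Int[OF inj KX] L(2) by blast
      also have "K \<inter> L = {}" using L(2) by blast
      finally show ?thesis using compactin_subset_topspace[OF gK] by auto
    qed
    ultimately obtain r \<phi> where r: "0 < r" and \<phi>: "\<phi> \<in> lip1" "\<forall>y\<in>M. \<phi> y \<le> r"
        "\<forall>y\<in>g ` K. \<phi> y = r" "\<forall>y\<in>M - (M - g ` L). \<phi> y = 0"
      by (rule lip1_bump[OF gK])
    have gM: "g x \<in> M" if "x \<in> topspace X" for x
      using g that by (auto simp: continuous_map_def)
    have int: "integrable \<kappa> (\<lambda>x. \<phi> (g x))" if "\<kappa> \<in> radon_probs X" for \<kappa>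
      using integrable_radon[OF that] lip1_compose[OF g \<phi>(1)] by blast
    have Ls: "L \<in> sets \<nu>" "topspace X - L \<in> sets \<nu>"
      using compact_in_sets_radon[OF \<nu> H L(1)] open_in_sets_radon[OF \<nu>]
        compactin_imp_closedin[OF H L(1)] by (auto simp: closedin_def)
    have "r * measure \<mu> K = (\<integral>x. r * indicator K x \<partial>\<mu>)"
      using Ks by simp
    also have "\<dots> \<le> (\<integral>x. \<phi> (g x) \<partial>\<mu>)"
    proof (rule integral_mono)
      show "integrable \<mu> (\<lambda>x. r * indicator K x)" using Ks by (simp add: \<mu>.emeasure_eq_measure)
      fix x assume "x \<in> space \<mu>"
      then have "0 \<le> \<phi> (g x)"
        using lip1_compose(2)[OF g \<phi>(1)] radon_probsD(3)[OF \<mu>] by simp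
      then show "r * indicator K x \<le> \<phi> (g x)"
        using \<phi>(3) by (cases "x \<in> K") auto
    qed (rule int[OF \<mu>])
    also have "\<dots> = (\<integral>x. \<phi> (g x) \<partial>\<nu>)"
      using fun_cong[OF eq, of \<phi>] \<phi>(1) by (simp add: lip1_integral_def)
    also have "\<dots> \<le> (\<integral>x. r * indicator (topspace X - L) x \<partial>\<nu>)"
    proof (rule integral_mono)
      show "integrable \<nu> (\<lambda>x. r * indicator (topspace X - L) x)"
        using Ls by (simp add: \<nu>.emeasure_eq_measure)
      fix x assume "x \<in> space \<nu>"
      then have x: "x \<in> topspace X" using radon_probsD(3)[OF \<nu>] by simp
      show "\<phi> (g x) \<le> r * indicator (topspace X - L) x"
      proof (cases "x \<in> L")
        case True
        then show ?thesis using \<phi>(4) gM[OF x] by simp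
      next
        case False
        then show ?thesis using \<phi>(2) gM[OF x] x by simp
      qed
    qed (rule int[OF \<nu>])
    also have "\<dots> = r * measure \<nu> (topspace X - L)"
      using Ls by simp
    finally have "measure \<mu> K \<le> measure \<nu> (topspace X - L)"
      using r by simp
    also have "\<dots> = 1 - measure \<nu> L"
      by (rule measure_compl_radon[OF \<nu> Ls(1)])
    also have "\<dots> \<le> measure \<nu> K + e"
      using L(3) measure_compl_radon[OF \<nu> Ks(2)] by linarith
    finally show "measure \<mu> K \<le> measure \<nu> K + e" .
  qed
  fix \<mu> \<nu> assume *: "\<mu> \<in> radon_probs X" "\<nu> \<in> radon_probs X" "lip1_integral g \<mu> = lip1_integral g \<nu>"
  show "\<mu> = \<nu>"
  proof (rule radon_eqI_compact[OF *(1,2) H])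
    fix K assume "compactin X K"
    then show "measure \<mu> K = measure \<nu> K"
      using le[OF *(1,2) _ *(3)] le[OF *(2,1) _ *(3)[symmetric]] by (simp add: antisym)
  qed
qed

end

lemma radon_seq_compact:
  assumes X: "Hausdorff_space X" and Y: "metrizable_space Y"
    and g: "continuous_map X Y g" "inj_on g (topspace X)"
    and K: "compactin (radon_prob_space X) K" and \<sigma>: "range (\<sigma> :: nat \<Rightarrow> _) \<subseteq> K"
  obtains l r where "l \<in> K" "strict_mono r" "limitin (radon_prob_space X) (\<sigma> \<circ> r) l sequentially"
proof -
  obtain D d where "Metric_space D d" and Y: "Y = Metric_space.mtopology D d"
    using Y unfolding metrizable_space_def by blast
  then interpret Metric_space D d by simp
  interpret F: Metric_space functionals fun_dist by (rule Metric_space_functionals)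
  have g': "continuous_map X mtopology g" using g(1) Y by simp
  show thesis
  proof (rule compactin_imp_seq_compact_if_injection[OF continuous_lip1_integral[OF g' X] _ _ K \<sigma>])
    show "inj_on (lip1_integral g) (topspace (radon_prob_space X))"
      using inj_lip1_integral[OF g' g(2) X] by (simp add: topspace_radon_prob_space)
    show "metrizable_space F.mtopology" by (rule F.metrizable_space_mtopology)
  qed (rule that)
qed

section \<open>Lifting measures through a subproper map\<close>

lemma accumulation_pointI_subsequence:
  assumes r: "strict_mono r" and lim: "limitin T (y \<circ> r) p sequentially"
  shows "accumulation_point_in T y p"
  unfolding accumulation_point_in_def
proof (intro conjI allI impI)
  show "p \<in> topspace T" by (rule limitin_topspace[OF lim])
  fix U assume "openin T U \<and> p \<in> U"
  then have "\<forall>\<^sub>F n in sequentially. (y \<circ> r) n \<in> U"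
    using lim by (simp add: limitin_def)
  then obtain N where N: "\<And>n. n \<ge> N \<Longrightarrow> y (r n) \<in> U"
    by (auto simp: eventually_sequentially)
  have "infinite (r ` {N..})"
    using strict_mono_imp_inj_on[OF r] finite_imageD infinite_Ici by (metis inj_on_subset subset_UNIV)
  moreover have "r ` {N..} \<subseteq> {n. y n \<in> U}" using N by auto
  ultimately show "infinite {n. y n \<in> U}" using infinite_super by blast
qed

lemma (in Metric_space) compact_closure_sequentially:
  assumes S: "S \<subseteq> M"
    and seq: "\<And>\<sigma> :: nat \<Rightarrow> 'a. range \<sigma> \<subseteq> S \<Longrightarrow> \<exists>l r. strict_mono r \<and> limitin mtopology (\<sigma> \<circ> r) l sequentially"
  shows "compactin mtopology (mtopology closure_of S)"
proof -
  have "\<exists>l r. l \<in> M \<and> strict_mono r \<and> limitin mtopology (\<sigma> \<circ> r) l sequentially"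
    if "range \<sigma> \<subseteq> S" for \<sigma> :: "nat \<Rightarrow> 'a"
    using seq[OF that] limitin_mspace by blast
  then have "\<forall>T. T \<subseteq> S \<and> infinite T \<longrightarrow> M \<inter> mtopology derived_set_of T \<noteq> {}"
    using Bolzano_Weierstrass_property[OF S S] by auto
  then show ?thesis
    unfolding compact_closure_of_eq_Bolzano_Weierstrass by auto
qed

text \<open>
  The map \<open>f\<close> and the section \<open>s\<close> come from a subproper map. The set \<open>C\<close> in the last assumption
  is made to lie over \<open>K\<close> in \<open>compact_lift_over\<close>, by intersecting it with the preimage of \<open>K\<close>.
\<close>

locale compact_lift = Metric_space M d for M :: "'m set" and d +
  fixes X :: "'a topology" and f :: "'m \<Rightarrow> 'a" and s :: "'a \<Rightarrow> 'm"
  assumes X_Hausdorff: "Hausdorff_space X" and X_regular: "regular_space X"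
    and f_continuous: "continuous_map mtopology X f"
    and s_in: "x \<in> topspace X \<Longrightarrow> s x \<in> M" and f_s: "x \<in> topspace X \<Longrightarrow> f (s x) = x"
    and lift: "compactin X K \<Longrightarrow> \<exists>C. compactin mtopology C \<and> s ` K \<subseteq> C"

sublocale compact_lift \<subseteq> F: Metric_space functionals fun_dist
  by (rule Metric_space_functionals)

context compact_lift
begin

lemma compact_lift_over:
  assumes K: "compactin X K"
  obtains C where "compactin mtopology C" "s ` K \<subseteq> C" "f ` C \<subseteq> K"
proof -
  obtain C where C: "compactin mtopology C" "s ` K \<subseteq> C"
    using lift[OF K] by blast
  have KX: "K \<subseteq> topspace X" using compactin_subset_topspace[OF K] .
  have "closedin mtopology {m \<in> topspace mtopology. f m \<in> K}"
    using closedin_continuous_map_preimage[OF f_continuous compactin_imp_closedin[OF X_Hausdorff K]] .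
  then have "compactin mtopology ({m \<in> topspace mtopology. f m \<in> K} \<inter> C)"
    using closed_Int_compactin C(1) by blast
  moreover have "s ` K \<subseteq> {m \<in> topspace mtopology. f m \<in> K} \<inter> C"
    using C(2) KX s_in f_s by auto
  ultimately show thesis using that by blast
qed

definition majorants :: "'a measure \<Rightarrow> ('m \<Rightarrow> real) \<Rightarrow> ('a \<Rightarrow> real) set" where
  "majorants \<mu> \<phi> = {g. integrable \<mu> g \<and> (\<forall>x\<in>topspace X. \<phi> (s x) \<le> g x)}"

definition upper_integral :: "'a measure \<Rightarrow> ('m \<Rightarrow> real) \<Rightarrow> real" where
  "upper_integral \<mu> \<phi> = (INF g\<in>majorants \<mu> \<phi>. integral\<^sup>L \<mu> g)"

lemma const_majorant:
  assumes "\<mu> \<in> radon_probs X" "\<phi> \<in> lip1"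
  shows "(\<lambda>_. 1) \<in> majorants \<mu> \<phi>"
proof -
  interpret prob_space \<mu> using radon_probsD(1)[OF assms(1)] .
  show ?thesis using lip1D(2)[OF assms(2)] s_in by (simp add: majorants_def)
qed

lemma upper_integral_ge:
  assumes \<mu>: "\<mu> \<in> radon_probs X" and \<phi>: "\<phi> \<in> lip1" and A: "A \<in> sets \<mu>"
    and ge: "\<And>x. x \<in> A \<Longrightarrow> c \<le> \<phi> (s x)"
  shows "c * measure \<mu> A \<le> upper_integral \<mu> \<phi>"
  unfolding upper_integral_def
proof (rule cINF_greatest)
  show "majorants \<mu> \<phi> \<noteq> {}" using const_majorant[OF \<mu> \<phi>] by blast
  fix g assume g: "g \<in> majorants \<mu> \<phi>"
  interpret prob_space \<mu> using radon_probsD(1)[OF \<mu>] .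
  have sp: "space \<mu> = topspace X" using radon_probsD(3)[OF \<mu>] .
  have "c * measure \<mu> A = (\<integral>x. c * indicator A x \<partial>\<mu>)"
    using A by simp
  also have "\<dots> \<le> integral\<^sup>L \<mu> g"
  proof (rule integral_mono)
    show "integrable \<mu> (\<lambda>x. c * indicator A x)"
      using A by (simp add: emeasure_eq_measure)
    show "integrable \<mu> g" using g by (simp add: majorants_def)
    fix x assume "x \<in> space \<mu>"
    then have x: "x \<in> topspace X" using sp by simp
    then have "0 \<le> \<phi> (s x)" "\<phi> (s x) \<le> g x"
      using lip1D(1)[OF \<phi> s_in] g by (auto simp: majorants_def)
    then show "c * indicator A x \<le> g x"
      using ge[of x] by (auto simp: indicator_def)
  qed
  finally show "c * measure \<mu> A \<le> integral\<^sup>L \<mu> g" .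
qed

lemma majorants_bdd_below:
  assumes \<mu>: "\<mu> \<in> radon_probs X" and \<phi>: "\<phi> \<in> lip1"
  shows "bdd_below (integral\<^sup>L \<mu> ` majorants \<mu> \<phi>)"
proof (rule bdd_belowI2)
  fix g assume g: "g \<in> majorants \<mu> \<phi>"
  show "0 \<le> integral\<^sup>L \<mu> g"
  proof (rule Bochner_Integration.integral_nonneg)
    fix x assume "x \<in> space \<mu>"
    then have x: "x \<in> topspace X" using radon_probsD(3)[OF \<mu>] by simp
    then show "0 \<le> g x"
      using lip1D(1)[OF \<phi> s_in[OF x]] g by (force simp: majorants_def)
  qed
qed

lemma upper_integral_le:
  assumes "\<mu> \<in> radon_probs X" "\<phi> \<in> lip1" "g \<in> majorants \<mu> \<phi>"
  shows "upper_integral \<mu> \<phi> \<le> integral\<^sup>L \<mu> g"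
  unfolding upper_integral_def
  by (rule cINF_lower[OF majorants_bdd_below[OF assms(1,2)] assms(3)])

lemma upper_integral_range:
  assumes \<mu>: "\<mu> \<in> radon_probs X" and \<phi>: "\<phi> \<in> lip1"
  shows "0 \<le> upper_integral \<mu> \<phi> \<and> upper_integral \<mu> \<phi> \<le> 1"
proof -
  interpret prob_space \<mu> using radon_probsD(1)[OF \<mu>] .
  show ?thesis
    using upper_integral_ge[OF \<mu> \<phi>, of "{}" 0] upper_integral_le[OF \<mu> \<phi> const_majorant[OF \<mu> \<phi>]]
    by (simp add: prob_space)
qed

text \<open>
  Outside \<open>K\<close> both functions lie between zero and one, so adding \<open>\<epsilon>\<close> and the indicator of the
  complement of \<open>K\<close> turns a majorant for \<open>\<psi>\<close> into one for \<open>\<phi>\<close>.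
\<close>

lemma upper_integral_tail:
  assumes \<mu>: "\<mu> \<in> radon_probs X" and \<phi>: "\<phi> \<in> lip1" and \<psi>: "\<psi> \<in> lip1" and K: "compactin X K"
    and \<epsilon>: "0 \<le> \<epsilon>" and le: "\<And>x. x \<in> K \<Longrightarrow> \<phi> (s x) \<le> \<psi> (s x) + \<epsilon>"
  shows "upper_integral \<mu> \<phi> \<le> upper_integral \<mu> \<psi> + \<epsilon> + measure \<mu> (topspace X - K)"
proof -
  interpret prob_space \<mu> using radon_probsD(1)[OF \<mu>] .
  let ?T = "topspace X - K"
  have T: "?T \<in> sets \<mu>"
    using open_in_sets_radon[OF \<mu>] compactin_imp_closedin[OF X_Hausdorff K] by (simp add: closedin_def)
  have "upper_integral \<mu> \<phi> - \<epsilon> - measure \<mu> ?T \<le> upper_integral \<mu> \<psi>"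
    unfolding upper_integral_def[of \<mu> \<psi>]
  proof (rule cINF_greatest)
    show "majorants \<mu> \<psi> \<noteq> {}" using const_majorant[OF \<mu> \<psi>] by blast
    fix g assume g: "g \<in> majorants \<mu> \<psi>"
    have ig: "integrable \<mu> g" using g by (simp add: majorants_def)
    let ?g = "\<lambda>x. g x + (\<epsilon> + indicator ?T x)"
    have "?g \<in> majorants \<mu> \<phi>"
      unfolding majorants_def
    proof (intro CollectI conjI ballI)
      show "integrable \<mu> ?g" using ig T by (simp add: emeasure_eq_measure)
      fix x assume x: "x \<in> topspace X"
      have "\<psi> (s x) \<le> g x" "0 \<le> \<psi> (s x)" "\<phi> (s x) \<le> 1"
        using g x lip1D(1)[OF \<psi> s_in[OF x]] lip1D(2)[OF \<phi> s_in[OF x]] by (auto simp: majorants_def)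
      then show "\<phi> (s x) \<le> ?g x"
        using le[of x] x \<epsilon> by (cases "x \<in> K") auto
    qed
    then have "upper_integral \<mu> \<phi> \<le> integral\<^sup>L \<mu> ?g"
      by (rule upper_integral_le[OF \<mu> \<phi>])
    also have "\<dots> = integral\<^sup>L \<mu> g + (\<epsilon> + measure \<mu> ?T)"
      using ig T by (simp add: emeasure_eq_measure prob_space)
    finally show "upper_integral \<mu> \<phi> - \<epsilon> - measure \<mu> ?T \<le> integral\<^sup>L \<mu> g" by simp
  qed
  then show ?thesis by simp
qed

lemma upper_integral_step_bound:
  assumes \<mu>: "\<mu> \<in> radon_probs X" and \<phi>: "\<phi> \<in> lip1" and A: "A \<in> sets \<mu>" and "0 \<le> \<delta>"
    and le: "\<And>x. x \<in> topspace X \<Longrightarrow> \<phi> (s x) \<le> r" "\<And>x. x \<in> topspace X - A \<Longrightarrow> \<phi> (s x) \<le> \<delta>"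
  shows "upper_integral \<mu> \<phi> \<le> \<delta> + r * measure \<mu> A"
proof -
  interpret prob_space \<mu> using radon_probsD(1)[OF \<mu>] .
  let ?g = "\<lambda>x. \<delta> + r * indicator A x"
  have "?g \<in> majorants \<mu> \<phi>"
    unfolding majorants_def
  proof (intro CollectI conjI ballI)
    show "integrable \<mu> ?g" using A by (simp add: emeasure_eq_measure)
    fix x assume "x \<in> topspace X"
    then show "\<phi> (s x) \<le> ?g x" using le[of x] \<open>0 \<le> \<delta>\<close> by (cases "x \<in> A") auto
  qed
  then have "upper_integral \<mu> \<phi> \<le> integral\<^sup>L \<mu> ?g"
    by (rule upper_integral_le[OF \<mu> \<phi>])
  also have "\<dots> = \<delta> + r * measure \<mu> A"
    using A by (simp add: emeasure_eq_measure prob_space)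
  finally show ?thesis .
qed

definition upper :: "'a measure \<Rightarrow> ('m \<Rightarrow> real) \<Rightarrow> real" where
  "upper \<mu> = restrict (upper_integral \<mu>) lip1"

lemma upper_apply [simp]: "\<phi> \<in> lip1 \<Longrightarrow> upper \<mu> \<phi> = upper_integral \<mu> \<phi>"
  by (simp add: upper_def)

lemma upper_in_functionals: "\<mu> \<in> radon_probs X \<Longrightarrow> upper \<mu> \<in> functionals"
  unfolding upper_def by (rule restrict_in_functionals) (rule upper_integral_range)

definition bumps :: "'a set \<Rightarrow> real \<Rightarrow> ('m \<Rightarrow> real) set" where
  "bumps U r = {\<phi> \<in> lip1. (\<forall>m\<in>M. \<phi> m \<le> r) \<and> (\<forall>m\<in>M. f m \<notin> U \<longrightarrow> \<phi> m = 0)}"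

text \<open>
  The measure of an open set \<open>U\<close> is the supremum of \<open>\<Phi> \<phi> / r\<close> over the bumps \<open>\<phi>\<close> of height at
  most \<open>r\<close> over \<open>U\<close>, so \<open>\<Phi>\<close> determines \<open>\<mu>\<close>. The height \<open>r\<close> cannot be normalised to one within
  \<open>lip1\<close>.
\<close>

definition represents :: "(('m \<Rightarrow> real) \<Rightarrow> real) \<Rightarrow> 'a measure \<Rightarrow> bool" where
  "represents \<Phi> \<mu> \<longleftrightarrow> \<Phi> \<in> functionals \<and> \<mu> \<in> radon_probs X \<and> (\<forall>U. openin X U \<longrightarrow>
     (\<forall>r>0. \<forall>\<phi>\<in>bumps U r. \<Phi> \<phi> \<le> r * measure \<mu> U) \<and>
     (\<forall>\<epsilon>>0. \<exists>r>0. \<exists>\<phi>\<in>bumps U r. r * (measure \<mu> U - \<epsilon>) < \<Phi> \<phi>))"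

lemma representsD:
  assumes "represents \<Phi> \<mu>"
  shows "\<Phi> \<in> functionals" "\<mu> \<in> radon_probs X"
    "\<lbrakk>openin X U; r > 0; \<phi> \<in> bumps U r\<rbrakk> \<Longrightarrow> \<Phi> \<phi> \<le> r * measure \<mu> U"
  using assms by (auto simp: represents_def)

lemma representsE:
  assumes "represents \<Phi> \<mu>" "openin X U" "\<epsilon> > 0"
  obtains r \<phi> where "r > 0" "\<phi> \<in> bumps U r" "r * (measure \<mu> U - \<epsilon>) < \<Phi> \<phi>"
  using assms unfolding represents_def by meson

text \<open>
  A bump that almost computes \<open>\<mu> U\<close> for \<open>\<Phi>\<close> gives almost the same lower bound for nearby
  functionals. This is both the continuity of the projection and, for \<open>\<Psi> = \<Phi>\<close>, the uniqueness of
  the represented measure.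
\<close>

lemma represents_nearby:
  assumes \<Phi>: "represents \<Phi> \<mu>" and U: "openin X U" and a: "a < measure \<mu> U"
  obtains e where "e > 0" "\<And>\<Psi> \<nu>. \<lbrakk>represents \<Psi> \<nu>; fun_dist \<Phi> \<Psi> < e\<rbrakk> \<Longrightarrow> a < measure \<nu> U"
proof -
  have "(measure \<mu> U - a) / 2 > 0" using a by simp
  then obtain r \<phi> where r: "r > 0" and \<phi>: "\<phi> \<in> bumps U r"
      and big: "r * (measure \<mu> U - (measure \<mu> U - a) / 2) < \<Phi> \<phi>"
    using representsE[OF \<Phi> U] by metis
  have "a < measure \<nu> U"
    if \<Psi>: "represents \<Psi> \<nu>" and near: "fun_dist \<Phi> \<Psi> < r * ((measure \<mu> U - a) / 2)" for \<Psi> \<nu>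
  proof -
    have "\<phi> \<in> lip1" using \<phi> by (simp add: bumps_def)
    then have "\<bar>\<Phi> \<phi> - \<Psi> \<phi>\<bar> < r * ((measure \<mu> U - a) / 2)"
      using fun_dist_ge[OF representsD(1)[OF \<Phi>] representsD(1)[OF \<Psi>]] near by fastforce
    then have "r * (measure \<mu> U - (measure \<mu> U - a) / 2) - r * ((measure \<mu> U - a) / 2) < \<Psi> \<phi>"
      using big by linarith
    also have "\<Psi> \<phi> \<le> r * measure \<nu> U"
      using representsD(3)[OF \<Psi> U r \<phi>] .
    finally have "r * a < r * measure \<nu> U"
      by (simp add: algebra_simps)
    then show ?thesis using r by simp
  qed
  then show thesis
    using that[of "r * ((measure \<mu> U - a) / 2)"] r a by simp
qed

lemma represents_unique:
  assumes "represents \<Phi> \<mu>" "represents \<Phi> \<nu>"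
  shows "\<mu> = \<nu>"
proof (rule radon_eqI_open[OF representsD(2)[OF assms(1)] representsD(2)[OF assms(2)]])
  have z: "fun_dist \<Phi> \<Phi> = 0" using representsD(1)[OF assms(1)] by simp
  have le: "measure \<mu> U \<le> measure \<nu> U" if "represents \<Phi> \<mu>" "represents \<Phi> \<nu>" "openin X U" for \<mu> \<nu> U
  proof (rule ccontr)
    assume "\<not> ?thesis"
    then have "measure \<nu> U < measure \<mu> U" by simp
    then obtain e where "e > 0" "\<And>\<Psi> \<kappa>. \<lbrakk>represents \<Psi> \<kappa>; fun_dist \<Phi> \<Psi> < e\<rbrakk> \<Longrightarrow> measure \<nu> U < measure \<kappa> U"
      using represents_nearby[OF \<open>represents \<Phi> \<mu>\<close> \<open>openin X U\<close>] by metis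
    then show False using \<open>represents \<Phi> \<nu>\<close> z by (metis less_irrefl)
  qed
  fix U assume "openin X U"
  then show "measure \<mu> U = measure \<nu> U"
    using le[OF assms] le[OF assms(2,1)] by (simp add: antisym)
qed

definition represented :: "(('m \<Rightarrow> real) \<Rightarrow> real) set" where
  "represented = {\<Phi>. \<exists>\<mu>. represents \<Phi> \<mu>}"

definition rep_space :: "(('m \<Rightarrow> real) \<Rightarrow> real) topology" where
  "rep_space = subtopology F.mtopology represented"

definition proj :: "(('m \<Rightarrow> real) \<Rightarrow> real) \<Rightarrow> 'a measure" where
  "proj \<Phi> = (THE \<mu>. represents \<Phi> \<mu>)"

lemma proj_eq: "represents \<Phi> \<mu> \<Longrightarrow> proj \<Phi> = \<mu>"
  unfolding proj_def using represents_unique by blast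

lemma represented_subset: "represented \<subseteq> functionals"
  by (auto simp: represented_def represents_def)

lemma topspace_rep_space: "topspace rep_space = represented"
  using represented_subset by (auto simp: rep_space_def)

lemma metrizable_rep_space: "metrizable_space rep_space"
  unfolding rep_space_def using F.metrizable_space_mtopology metrizable_space_subtopology by blast

lemma continuous_proj: "continuous_map rep_space (radon_prob_space X) proj"
  unfolding radon_prob_space_def
proof (rule continuous_on_generated_topo)
  have in_radon: "proj \<Phi> \<in> radon_probs X" if "\<Phi> \<in> represented" for \<Phi>
    using that proj_eq representsD(2) unfolding represented_def by force
  then show "proj ` topspace rep_space \<subseteq> \<Union>{{\<mu> \<in> radon_probs X. measure \<mu> U > a} |a U. openin X U}"
    using topspace_radon_prob_space[of X]
    by (auto simp: topspace_rep_space radon_prob_space_def)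
  fix W assume "W \<in> {{\<mu> \<in> radon_probs X. measure \<mu> U > a} |a U. openin X U}"
  then obtain a U where W: "W = {\<mu> \<in> radon_probs X. measure \<mu> U > a}" and U: "openin X U"
    by blast
  show "openin rep_space (proj -` W \<inter> topspace rep_space)"
  proof (subst openin_subopen, intro ballI)
    fix \<Phi> assume "\<Phi> \<in> proj -` W \<inter> topspace rep_space"
    then obtain \<mu> where \<mu>: "represents \<Phi> \<mu>" "proj \<Phi> = \<mu>" "a < measure \<mu> U"
      using proj_eq by (auto simp: topspace_rep_space represented_def W)
    obtain e where e: "e > 0" "\<And>\<Psi> \<nu>. \<lbrakk>represents \<Psi> \<nu>; fun_dist \<Phi> \<Psi> < e\<rbrakk> \<Longrightarrow> a < measure \<nu> U"
      using represents_nearby[OF \<mu>(1) U \<mu>(3)] by metis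
    have "F.mball \<Phi> e \<inter> represented \<subseteq> proj -` W \<inter> topspace rep_space"
    proof
      fix \<Psi> assume \<Psi>: "\<Psi> \<in> F.mball \<Phi> e \<inter> represented"
      then obtain \<nu> where \<nu>: "represents \<Psi> \<nu>" by (auto simp: represented_def)
      have "a < measure \<nu> U" using e(2)[OF \<nu>] \<Psi> by simp
      then show "\<Psi> \<in> proj -` W \<inter> topspace rep_space"
        using \<Psi> \<nu> proj_eq[OF \<nu>] representsD(2)[OF \<nu>] by (simp add: W topspace_rep_space)
    qed
    moreover have "openin rep_space (F.mball \<Phi> e \<inter> represented)"
      unfolding rep_space_def openin_subtopology using F.openin_mball by blast
    moreover have "\<Phi> \<in> F.mball \<Phi> e \<inter> represented"
      using e(1) \<mu>(1) representsD(1)[OF \<mu>(1)] by (auto simp: represented_def)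
    ultimately show "\<exists>T. openin rep_space T \<and> \<Phi> \<in> T \<and> T \<subseteq> proj -` W \<inter> topspace rep_space"
      by (intro exI conjI)
  qed
qed

text \<open>
  Tightness provides the convergent subsequence. Its limit represents \<open>\<nu>\<close>, because the two bounds
  in the definition use the two semicontinuity properties of the topology. For the upper bound,
  up to errors of size \<open>\<delta>\<close> a bump over \<open>U\<close> only sees a compact subset of \<open>U\<close>, and the measure of
  a closed set is upper semicontinuous. For the lower bound, the measure of an open \<open>V\<close> inside a
  closed \<open>A \<subseteq> U\<close> is lower semicontinuous, and all but \<open>\<epsilon>/4\<close> of it sits on a compact subset of
  \<open>A\<close>, whose lift admits a bump of full height.
\<close>

lemma upper_subsequence:
  assumes lim: "limitin (radon_prob_space X) \<sigma> \<nu> sequentially" and tight: "uniformly_tight X (range \<sigma>)"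
  obtains \<Phi> r where "strict_mono r" "represents \<Phi> \<nu>"
    "limitin F.mtopology (upper \<circ> \<sigma> \<circ> r) \<Phi> sequentially"
proof -
  have \<nu>: "\<nu> \<in> radon_probs X"
    using limitin_topspace[OF lim] by (simp add: topspace_radon_prob_space)
  have \<sigma>: "\<sigma> n \<in> radon_probs X" for n
    using tight by (auto simp: uniformly_tight_def)
  have tightE: "\<exists>K. compactin X K \<and> (\<forall>n. measure (\<sigma> n) (topspace X - K) < \<epsilon>)" if "\<epsilon> > 0" for \<epsilon>
    using tight that unfolding uniformly_tight_def by simp
  obtain \<Phi> r where r: "strict_mono r"
      and \<Phi>: "limitin F.mtopology ((upper \<circ> \<sigma>) \<circ> r) \<Phi> sequentially"
  proof (rule tight_functionals_convergent_subsequence[of "upper \<circ> \<sigma>"])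
    show "(upper \<circ> \<sigma>) n \<in> functionals" for n
      using upper_in_functionals[OF \<sigma>] by simp
    show "0 \<le> (upper \<circ> \<sigma>) n \<phi> \<and> (upper \<circ> \<sigma>) n \<phi> \<le> 1" if "\<phi> \<in> lip1" for n \<phi>
      using upper_integral_range[OF \<sigma> that] that by simp
    fix \<epsilon> :: real assume \<epsilon>: "\<epsilon> > 0"
    obtain K where K: "compactin X K" "\<And>n. measure (\<sigma> n) (topspace X - K) < \<epsilon>"
      using tightE[OF \<epsilon>] by metis
    obtain C where C: "compactin mtopology C" "s ` K \<subseteq> C"
      using lift[OF K(1)] by blast
    have close: "upper_integral (\<sigma> n) \<phi> \<le> upper_integral (\<sigma> n) \<psi> + 2 * \<epsilon>"
      if \<phi>: "\<phi> \<in> lip1" and \<psi>: "\<psi> \<in> lip1" and cl: "\<forall>x\<in>C. \<bar>\<phi> x - \<psi> x\<bar> < \<epsilon>" for n \<phi> \<psi>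
    proof -
      have "\<phi> (s x) \<le> \<psi> (s x) + \<epsilon>" if "x \<in> K" for x
        using cl C(2) that by force
      then have "upper_integral (\<sigma> n) \<phi> \<le> upper_integral (\<sigma> n) \<psi> + \<epsilon> + measure (\<sigma> n) (topspace X - K)"
        using upper_integral_tail[OF \<sigma> \<phi> \<psi> K(1)] \<epsilon> by simp
      then show ?thesis using K(2)[of n] by linarith
    qed
    have "\<bar>(upper \<circ> \<sigma>) n \<phi> - (upper \<circ> \<sigma>) n \<psi>\<bar> \<le> 2 * \<epsilon>"
      if \<phi>: "\<phi> \<in> lip1" and \<psi>: "\<psi> \<in> lip1" and cl: "\<forall>x\<in>C. \<bar>\<phi> x - \<psi> x\<bar> < \<epsilon>" for n \<phi> \<psi>
    proof -
      have "\<forall>x\<in>C. \<bar>\<psi> x - \<phi> x\<bar> < \<epsilon>" using cl by (simp add: abs_minus_commute)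
      then show ?thesis
        using close[OF \<phi> \<psi> cl, of n] close[OF \<psi> \<phi>, of n] \<phi> \<psi> by (simp add: abs_le_iff)
    qed
    then show "\<exists>S. mtotally_bounded S \<and> (\<forall>n. \<forall>\<phi>\<in>lip1. \<forall>\<psi>\<in>lip1. (\<forall>x\<in>S. \<bar>\<phi> x - \<psi> x\<bar> < \<epsilon>) \<longrightarrow>
        \<bar>(upper \<circ> \<sigma>) n \<phi> - (upper \<circ> \<sigma>) n \<psi>\<bar> \<le> 2 * \<epsilon>)"
      using compactin_imp_mtotally_bounded[OF C(1)] by (intro exI[of _ C]) simp
  qed
  define \<tau> where "\<tau> = \<sigma> \<circ> r"
  have \<tau>: "\<tau> n \<in> radon_probs X" for n
    using \<sigma> by (simp add: \<tau>_def)
  have lim\<tau>: "limitin (radon_prob_space X) \<tau> \<nu> sequentially"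
    unfolding \<tau>_def by (rule limitin_subsequence[OF r lim])
  have tight\<tau>: "\<exists>K. compactin X K \<and> (\<forall>n. measure (\<tau> n) (topspace X - K) < \<epsilon>)" if "\<epsilon> > 0" for \<epsilon>
    using tightE[OF that] by (auto simp: \<tau>_def)
  have conv: "(\<lambda>n. upper_integral (\<tau> n) \<phi>) \<longlonglongrightarrow> \<Phi> \<phi>" if "\<phi> \<in> lip1" for \<phi>
    using functionals_limit[OF \<Phi> that] that by (simp add: \<tau>_def)
  have "represents \<Phi> \<nu>"
    unfolding represents_def
  proof (intro conjI allI impI ballI)
    show "\<Phi> \<in> functionals" using F.limitin_mspace[OF \<Phi>] .
    show "\<nu> \<in> radon_probs X" by (rule \<nu>)
  next
    fix U r \<phi> assume U: "openin X U" and r: "(0::real) < r" and \<phi>: "\<phi> \<in> bumps U r"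
    have \<phi>l: "\<phi> \<in> lip1" and \<phi>r: "\<And>m. m \<in> M \<Longrightarrow> \<phi> m \<le> r"
        and \<phi>0: "\<And>m. \<lbrakk>m \<in> M; f m \<notin> U\<rbrakk> \<Longrightarrow> \<phi> m = 0"
      using \<phi> by (auto simp: bumps_def)
    have bound: "\<Phi> \<phi> \<le> \<delta> + r * (measure \<nu> U + 2 * \<delta>)" if \<delta>: "\<delta> > 0" for \<delta>
    proof -
      obtain K where K: "compactin X K" "\<And>n. measure (\<tau> n) (topspace X - K) < \<delta>"
        using tight\<tau>[OF \<delta>] by metis
      obtain C where C: "compactin mtopology C" "s ` K \<subseteq> C" "f ` C \<subseteq> K"
        using compact_lift_over[OF K(1)] by metis
      \<comment> \<open>The part of the lift where the bump is not negligible; it lies over a compact subset of \<open>U\<close>.\<close>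
      define D where "D = {m \<in> topspace mtopology. \<phi> m \<in> {\<delta>..}} \<inter> C"
      have "closedin mtopology {m \<in> topspace mtopology. \<phi> m \<in> {\<delta>..}}"
        by (rule closedin_continuous_map_preimage[OF lip1_continuous[OF \<phi>l]]) simp
      then have "compactin mtopology D"
        unfolding D_def using C(1) by (rule closed_Int_compactin)
      then have A: "compactin X (f ` D)"
        using image_compactin f_continuous by blast
      have AU: "f ` D \<subseteq> U"
      proof
        fix x assume "x \<in> f ` D"
        then obtain m where m: "m \<in> M" "\<delta> \<le> \<phi> m" "x = f m" by (auto simp: D_def)
        then show "x \<in> U" using \<phi>0[OF m(1)] \<delta> by force
      qed
      have "measure \<nu> (f ` D) \<le> measure \<nu> U"
        using measure_mono_radon[OF \<nu> open_in_sets_radon[OF \<nu> U] AU] .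
      then have "\<forall>\<^sub>F n in sequentially. measure (\<tau> n) (f ` D) < measure \<nu> U + \<delta>"
        using limitin_measure_less[OF lim\<tau> compactin_imp_closedin[OF X_Hausdorff A]] \<delta> by force
      then have "\<forall>\<^sub>F n in sequentially. upper_integral (\<tau> n) \<phi> \<le> \<delta> + r * (measure \<nu> U + 2 * \<delta>)"
      proof eventually_elim
        case (elim n)
        interpret prob_space "\<tau> n" using radon_probsD(1)[OF \<tau>] .
        let ?B = "f ` D \<union> (topspace X - K)"
        have m: "f ` D \<in> sets (\<tau> n)" "topspace X - K \<in> sets (\<tau> n)"
          using compact_in_sets_radon[OF \<tau> X_Hausdorff A] open_in_sets_radon[OF \<tau>]
            compactin_imp_closedin[OF X_Hausdorff K(1)] by (auto simp: closedin_def)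
        have "\<phi> (s x) \<le> \<delta>" if x: "x \<in> topspace X - ?B" for x
        proof (rule ccontr)
          assume "\<not> ?thesis"
          then have "s x \<in> D" using x C(2) s_in[of x] by (auto simp: D_def)
          then have "x \<in> f ` D" using f_s[of x] x by force
          then show False using x by blast
        qed
        moreover have "\<phi> (s x) \<le> r" if "x \<in> topspace X" for x
          using \<phi>r[OF s_in[OF that]] .
        moreover have "?B \<in> sets (\<tau> n)" using m by auto
        ultimately have "upper_integral (\<tau> n) \<phi> \<le> \<delta> + r * measure (\<tau> n) ?B"
          using upper_integral_step_bound[OF \<tau> \<phi>l, of ?B n \<delta> r] \<delta> by simp
        also have "measure (\<tau> n) ?B \<le> measure (\<tau> n) (f ` D) + measure (\<tau> n) (topspace X - K)"
          using m by (intro measure_Un_le)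
        also have "\<dots> \<le> measure \<nu> U + 2 * \<delta>"
          using elim K(2)[of n] by linarith
        finally show ?case using r by simp
      qed
      then show ?thesis
        by (intro tendsto_upperbound[OF conv[OF \<phi>l]]) simp_all
    qed
    show "\<Phi> \<phi> \<le> r * measure \<nu> U"
    proof (rule field_le_epsilon)
      fix e :: real assume e: "e > 0"
      \<comment> \<open>The errors in the bound add up to \<open>\<delta> * (1 + 2 * r)\<close>.\<close>
      define \<delta> where "\<delta> = e / (1 + 2 * r)"
      have "\<delta> > 0" using r e by (simp add: \<delta>_def)
      have "\<delta> * (1 + 2 * r) = e" using r by (simp add: \<delta>_def)
      then show "\<Phi> \<phi> \<le> r * measure \<nu> U + e"
        using bound[OF \<open>\<delta> > 0\<close>] by (simp add: algebra_simps)
    qed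
  next
    fix U and \<epsilon> :: real assume U: "openin X U" and \<epsilon>: "0 < \<epsilon>"
    have "measure \<nu> U - \<epsilon>/4 < measure \<nu> U" using \<epsilon> by simp
    then obtain V A where VA: "openin X V" "closedin X A" "V \<subseteq> A" "A \<subseteq> U" "measure \<nu> U - \<epsilon>/4 < measure \<nu> V"
      using radon_inner_open[OF \<nu> X_Hausdorff X_regular U] by metis
    have "\<epsilon>/4 > 0" using \<epsilon> by simp
    then obtain K where K: "compactin X K" "\<And>n. measure (\<tau> n) (topspace X - K) < \<epsilon>/4"
      using tight\<tau> by metis
    have L: "compactin X (A \<inter> K)"
      by (rule closed_Int_compactin[OF VA(2) K(1)])
    obtain C where C: "compactin mtopology C" "s ` (A \<inter> K) \<subseteq> C" "f ` C \<subseteq> A \<inter> K"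
      using compact_lift_over[OF L] by metis
    have CM: "C \<subseteq> M" using compactin_subset_topspace[OF C(1)] by simp
    let ?W = "{m \<in> topspace mtopology. f m \<in> U}"
    have "openin mtopology ?W"
      by (rule openin_continuous_map_preimage[OF f_continuous U])
    moreover have "C \<subseteq> ?W" using CM C(3) VA(4) by auto
    ultimately obtain r \<phi> where r: "0 < r" and \<phi>: "\<phi> \<in> lip1" "\<forall>x\<in>M. \<phi> x \<le> r"
        "\<forall>x\<in>C. \<phi> x = r" "\<forall>x\<in>M - ?W. \<phi> x = 0"
      by (rule lip1_bump[OF C(1)])
    have "\<phi> \<in> bumps U r" using \<phi> by (auto simp: bumps_def)
    have "\<forall>\<^sub>F n in sequentially. r * (measure \<nu> U - \<epsilon>/2) \<le> upper_integral (\<tau> n) \<phi>"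
      using limitin_measure_greater[OF lim\<tau> VA(1,5)]
    proof eventually_elim
      case (elim n)
      interpret prob_space "\<tau> n" using radon_probsD(1)[OF \<tau>] .
      have m: "A \<inter> K \<in> sets (\<tau> n)" "topspace X - K \<in> sets (\<tau> n)"
        using compact_in_sets_radon[OF \<tau> X_Hausdorff L] open_in_sets_radon[OF \<tau>]
          compactin_imp_closedin[OF X_Hausdorff K(1)] by (auto simp: closedin_def)
      have "measure (\<tau> n) V \<le> measure (\<tau> n) ((A \<inter> K) \<union> (topspace X - K))"
        using VA(3) openin_subset[OF VA(1)] m by (intro measure_mono_radon[OF \<tau>]) auto
      also have "\<dots> \<le> measure (\<tau> n) (A \<inter> K) + measure (\<tau> n) (topspace X - K)"
        using m by (intro measure_Un_le)
      finally have "measure \<nu> U - \<epsilon>/2 \<le> measure (\<tau> n) (A \<inter> K)"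
        using elim K(2)[of n] by linarith
      then have "r * (measure \<nu> U - \<epsilon>/2) \<le> r * measure (\<tau> n) (A \<inter> K)"
        using r by simp
      also have "\<dots> \<le> upper_integral (\<tau> n) \<phi>"
        using C(2) \<phi>(3) by (intro upper_integral_ge[OF \<tau> \<phi>(1) m(1)]) auto
      finally show ?case .
    qed
    then have "r * (measure \<nu> U - \<epsilon>/2) \<le> \<Phi> \<phi>"
      by (intro tendsto_lowerbound[OF conv[OF \<phi>(1)]]) simp_all
    moreover have "r * (measure \<nu> U - \<epsilon>) < r * (measure \<nu> U - \<epsilon>/2)"
      using r \<epsilon> by simp
    ultimately have "r * (measure \<nu> U - \<epsilon>) < \<Phi> \<phi>"
      by linarith
    then show "\<exists>r>0. \<exists>\<phi>\<in>bumps U r. r * (measure \<nu> U - \<epsilon>) < \<Phi> \<phi>"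
      using r \<open>\<phi> \<in> bumps U r\<close> by (intro exI[of _ r] conjI bexI[of _ \<phi>]) simp_all
  qed
  then show thesis using that r \<Phi> by (simp add: comp_assoc)
qed

text \<open>
  A constant sequence is tight and convergent, so this is the limit statement for it.
\<close>

lemma represents_upper:
  assumes \<mu>: "\<mu> \<in> radon_probs X"
  shows "represents (upper \<mu>) \<mu>"
proof -
  interpret prob_space \<mu> using radon_probsD(1)[OF \<mu>] .
  have lim: "limitin (radon_prob_space X) (\<lambda>_::nat. \<mu>) \<mu> sequentially"
    using \<mu> by (simp add: limitin_const_iff topspace_radon_prob_space)
  have "\<exists>K. compactin X K \<and> measure \<mu> (topspace X - K) < \<epsilon>" if "\<epsilon> > 0" for \<epsilon>
    using \<mu> that open_in_sets_radon[OF \<mu> openin_topspace] unfolding radon_probs_def by blast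
  then have "uniformly_tight X (range (\<lambda>_::nat. \<mu>))"
    using \<mu> by (simp add: uniformly_tight_def)
  then obtain \<Phi> and r :: "nat \<Rightarrow> nat" where \<Phi>: "represents \<Phi> \<mu>"
      "limitin F.mtopology (upper \<circ> (\<lambda>_. \<mu>) \<circ> r) \<Phi> sequentially"
    using upper_subsequence[OF lim] by metis
  have "upper \<circ> (\<lambda>_. \<mu>) \<circ> r = (\<lambda>_. upper \<mu>)" by auto
  moreover have "limitin F.mtopology (\<lambda>_::nat. upper \<mu>) (upper \<mu>) sequentially"
    using upper_in_functionals[OF \<mu>] by (simp add: limitin_const_iff)
  ultimately have "\<Phi> = upper \<mu>"
    using \<Phi>(2) F.limitin_metric_unique trivial_limit_sequentially by metis
  then show ?thesis using \<Phi>(1) by simp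
qed

lemma upper_subsequence_rep_space:
  assumes lim: "limitin (radon_prob_space X) \<sigma> \<nu> sequentially" and tight: "uniformly_tight X (range \<sigma>)"
  obtains \<Phi> r where "strict_mono r" "limitin rep_space (upper \<circ> \<sigma> \<circ> r) \<Phi> sequentially"
proof -
  obtain \<Phi> r where *: "strict_mono r" "represents \<Phi> \<nu>"
      "limitin F.mtopology (upper \<circ> \<sigma> \<circ> r) \<Phi> sequentially"
    using upper_subsequence[OF assms] by metis
  have "\<sigma> n \<in> radon_probs X" for n
    using tight by (auto simp: uniformly_tight_def)
  then have "(upper \<circ> \<sigma> \<circ> r) n \<in> represented" for n
    using represents_upper by (auto simp: represented_def)
  then have "limitin rep_space (upper \<circ> \<sigma> \<circ> r) \<Phi> sequentially"
    unfolding rep_space_def limitin_subtopology using * by (auto simp: represented_def)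
  then show thesis using that *(1) by blast
qed

lemma section_upper: "section_of rep_space (radon_prob_space X) proj upper"
  using represents_upper proj_eq
  by (auto simp: section_of_def topspace_radon_prob_space topspace_rep_space represented_def)

end

context compact_lift
begin

lemma cs_star_metrizable_radon_prob_space:
  assumes P: "sequentially_prohorov X"
  shows "cs_star_metrizable_space (radon_prob_space X)"
proof (rule cs_star_metrizable_spaceI[OF Hausdorff_radon_prob_space[OF X_Hausdorff X_regular]
      metrizable_rep_space continuous_proj section_upper])
  show "cs_star_continuous (radon_prob_space X) rep_space upper"
    unfolding cs_star_continuous_def
  proof (intro conjI allI impI)
    show "upper \<in> topspace (radon_prob_space X) \<rightarrow> topspace rep_space"
      using section_upper by (simp add: section_of_def)
    fix \<sigma> assume \<sigma>: "convergent_seq_in (radon_prob_space X) \<sigma>"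
    then have tight: "uniformly_tight X (range \<sigma>)"
      using P by (simp add: sequentially_prohorov_def)
    obtain \<nu> where "limitin (radon_prob_space X) \<sigma> \<nu> sequentially"
      using \<sigma> by (auto simp: convergent_seq_in_def)
    then obtain \<Phi> r where "strict_mono r" "limitin rep_space (upper \<circ> \<sigma> \<circ> r) \<Phi> sequentially"
      by (rule upper_subsequence_rep_space[OF _ tight])
    then have "accumulation_point_in rep_space (upper \<circ> \<sigma>) \<Phi>"
      by (rule accumulation_pointI_subsequence)
    then show "\<exists>p. accumulation_point_in rep_space (upper \<circ> \<sigma>) p" by blast
  qed
qed

text \<open>
  A sequence in the lift of a compact set of measures comes from a sequence of measures in this
  set. A subsequence of the latter converges, and a further subsequence of the lifts converges as
  well.
\<close>

lemma k_star_metrizable_radon_prob_space: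
  assumes P: "sequentially_prohorov X"
    and seq: "\<And>K (\<sigma> :: nat \<Rightarrow> _). \<lbrakk>compactin (radon_prob_space X) K; range \<sigma> \<subseteq> K\<rbrakk>
      \<Longrightarrow> \<exists>l r. l \<in> K \<and> strict_mono r \<and> limitin (radon_prob_space X) (\<sigma> \<circ> r) l sequentially"
  shows "k_star_metrizable_space (radon_prob_space X)"
proof (rule k_star_metrizable_spaceI[OF Hausdorff_radon_prob_space[OF X_Hausdorff X_regular]
      metrizable_rep_space])
  interpret R: Submetric functionals fun_dist represented
    by unfold_locales (rule represented_subset)
  have top: "R.sub.mtopology = rep_space"
    by (simp add: rep_space_def R.mtopology_submetric)
  have proj_upper: "proj (upper \<mu>) = \<mu>" "upper \<mu> \<in> represented" if "\<mu> \<in> radon_probs X" for \<mu>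
    using represents_upper[OF that] proj_eq by (auto simp: represented_def)
  show "subproper_map rep_space (radon_prob_space X) proj"
    unfolding subproper_map_def
  proof (intro conjI continuous_proj exI[of _ "upper ` radon_probs X"] allI impI)
    show "upper ` radon_probs X \<subseteq> topspace rep_space"
      using proj_upper(2) by (auto simp: topspace_rep_space)
    show "proj ` upper ` radon_probs X = topspace (radon_prob_space X)"
      using proj_upper(1) by (simp add: image_image topspace_radon_prob_space)
    fix \<K> assume \<K>: "precompactin (radon_prob_space X) \<K>"
    let ?S = "upper ` radon_probs X \<inter> proj -` \<K>"
    have K: "compactin (radon_prob_space X) (radon_prob_space X closure_of \<K>)"
      and sub: "\<K> \<subseteq> radon_prob_space X closure_of \<K>"
      using \<K> closure_of_subset by (auto simp: precompactin_def)
    have S: "?S \<subseteq> represented"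
      using proj_upper(2) by auto
    have "compactin R.sub.mtopology (R.sub.mtopology closure_of ?S)"
    proof (rule R.sub.compact_closure_sequentially[OF S])
      fix \<tau> :: "nat \<Rightarrow> _" assume \<tau>: "range \<tau> \<subseteq> ?S"
      define \<sigma> where "\<sigma> = proj \<circ> \<tau>"
      have \<tau>eq: "\<tau> n = upper (\<sigma> n) \<and> \<sigma> n \<in> radon_probs X \<and> \<sigma> n \<in> \<K>" for n
      proof -
        have "\<tau> n \<in> ?S" using \<tau> by blast
        then obtain \<mu> where "\<mu> \<in> radon_probs X" "\<tau> n = upper \<mu>" "proj (\<tau> n) \<in> \<K>" by blast
        then show ?thesis using proj_upper(1) by (simp add: \<sigma>_def)
      qed
      have "range \<sigma> \<subseteq> radon_prob_space X closure_of \<K>"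
        using \<tau>eq sub by auto
      then obtain l q where q: "strict_mono q" "limitin (radon_prob_space X) (\<sigma> \<circ> q) l sequentially"
        using seq[OF K] by metis
      have "convergent_seq_in (radon_prob_space X) (\<sigma> \<circ> q)"
        using q(2) \<tau>eq by (auto simp: convergent_seq_in_def topspace_radon_prob_space)
      then have "uniformly_tight X (range (\<sigma> \<circ> q))"
        using P unfolding sequentially_prohorov_def by blast
      from upper_subsequence_rep_space[OF q(2) this]
      obtain \<Phi> r where r: "strict_mono r" "limitin rep_space (upper \<circ> (\<sigma> \<circ> q) \<circ> r) \<Phi> sequentially"
        by metis
      have "upper \<circ> (\<sigma> \<circ> q) \<circ> r = \<tau> \<circ> (q \<circ> r)"
        using \<tau>eq by (auto simp: fun_eq_iff)
      then have "limitin R.sub.mtopology (\<tau> \<circ> (q \<circ> r)) \<Phi> sequentially"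
        using r(2) top by simp
      moreover have "strict_mono (q \<circ> r)"
        by (rule strict_mono_o[OF q(1) r(1)])
      ultimately show "\<exists>l r. strict_mono r \<and> limitin R.sub.mtopology (\<tau> \<circ> r) l sequentially"
        by blast
    qed
    then show "precompactin rep_space ?S"
      using S by (simp add: precompactin_def top topspace_rep_space)
  qed
qed

end

lemma k_star_metrizable_compact_liftE:
  fixes X :: "'a topology"
  assumes X: "k_star_metrizable_space X" and R: "regular_space X"
  obtains D d f s where "compact_lift (D :: (nat \<Rightarrow> 'a) set) d X f s"
proof -
  obtain M :: "(nat \<Rightarrow> 'a) topology" and f where H: "Hausdorff_space X" and M: "metrizable_space M"
    and f: "subproper_map M X f"
    using X unfolding k_star_metrizable_space_def by blast
  obtain D d where "Metric_space D d" and Md: "M = Metric_space.mtopology D d"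
    using M unfolding metrizable_space_def by blast
  then interpret Metric_space D d by simp
  obtain Z where Z: "Z \<subseteq> topspace M" "f ` Z = topspace X"
    and pre: "\<And>K. precompactin X K \<Longrightarrow> precompactin M (Z \<inter> f -` K)"
    and cf: "continuous_map M X f"
    using f unfolding subproper_map_def by blast
  have "\<forall>x\<in>topspace X. \<exists>z. z \<in> Z \<and> f z = x"
    using Z(2) by (metis imageE)
  then obtain s where s: "\<And>x. x \<in> topspace X \<Longrightarrow> s x \<in> Z \<and> f (s x) = x"
    by metis
  have "compact_lift D d X f s"
  proof (unfold_locales)
    show "Hausdorff_space X" "regular_space X" by (rule H R)+
    show "continuous_map mtopology X f" using cf Md by simp
    show "s x \<in> D" "f (s x) = x" if "x \<in> topspace X" for x
      using s[OF that] Z(1) Md by auto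
    fix K assume K: "compactin X K"
    have KX: "K \<subseteq> topspace X" using compactin_subset_topspace[OF K] .
    have "X closure_of K = K"
      using compactin_imp_closedin[OF H K] by (simp add: closure_of_closedin)
    then have "precompactin X K" using K KX by (simp add: precompactin_def)
    then have "precompactin M (Z \<inter> f -` K)" by (rule pre)
    then have C: "compactin M (M closure_of (Z \<inter> f -` K))" "Z \<inter> f -` K \<subseteq> topspace M"
      by (auto simp: precompactin_def)
    have "s ` K \<subseteq> Z \<inter> f -` K" using s KX by auto
    also have "\<dots> \<subseteq> M closure_of (Z \<inter> f -` K)" by (rule closure_of_subset[OF C(2)])
    finally show "\<exists>C. compactin mtopology C \<and> s ` K \<subseteq> C"
      using C(1) Md by blast
  qed
  then show thesis by (rule that)
qed

section \<open>Transfer between a space and its Radon measures\<close>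

theorem theorem9p9:
  fixes X :: "'a topology"
  assumes "tychonoff_space X" and "sequentially_prohorov X"
  shows "((k_star_metrizable_space (radon_prob_space X) \<longrightarrow> k_star_metrizable_space X) \<and>
          (cs_star_metrizable_space (radon_prob_space X) \<longrightarrow> cs_star_metrizable_space X)) \<and>
         (k_star_metrizable_space X \<longrightarrow> cs_star_metrizable_space (radon_prob_space X)) \<and>
         (submetrizable_space X \<and> k_star_metrizable_space X \<longrightarrow>
            k_star_metrizable_space (radon_prob_space X)) \<and>
         (aleph0_space X \<longleftrightarrow> aleph0_space (radon_prob_space X))"
proof (intro conjI impI iffI)
  have H: "Hausdorff_space X" and CR: "completely_regular_space X"
    using assms(1) by (auto simp: tychonoff_space_def)
  have R: "regular_space X"
    by (rule completely_regular_imp_regular_space[OF CR])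
  note dirac = embedding_map_dirac[OF H]
  show "k_star_metrizable_space X" if "k_star_metrizable_space (radon_prob_space X)"
    by (rule k_star_metrizable_embedding[OF dirac H that])
  show "cs_star_metrizable_space X" if "cs_star_metrizable_space (radon_prob_space X)"
    by (rule cs_star_metrizable_embedding[OF dirac H that])
  show "aleph0_space X" if "aleph0_space (radon_prob_space X)"
    by (rule aleph0_embedding[OF dirac H R that])
  show "cs_star_metrizable_space (radon_prob_space X)" if k: "k_star_metrizable_space X"
  proof -
    obtain D d f s where "compact_lift (D :: (nat \<Rightarrow> 'a) set) d X f s"
      by (rule k_star_metrizable_compact_liftE[OF k R])
    then show ?thesis
      using assms(2) by (rule compact_lift.cs_star_metrizable_radon_prob_space)
  qed
  show "k_star_metrizable_space (radon_prob_space X)"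
    if sub: "submetrizable_space X \<and> k_star_metrizable_space X"
  proof -
    obtain D d f s where lift: "compact_lift (D :: (nat \<Rightarrow> 'a) set) d X f s"
      by (rule k_star_metrizable_compact_liftE[OF conjunct2[OF sub] R])
    obtain Y :: "'a topology" and g where Y: "metrizable_space Y" "continuous_map X Y g"
        "bij_betw g (topspace X) (topspace Y)"
      using sub unfolding submetrizable_space_def by auto
    show ?thesis
    proof (rule compact_lift.k_star_metrizable_radon_prob_space[OF lift assms(2)])
      fix K and \<sigma> :: "nat \<Rightarrow> 'a measure"
      assume "compactin (radon_prob_space X) K" "range \<sigma> \<subseteq> K"
      then show "\<exists>l r. l \<in> K \<and> strict_mono r \<and> limitin (radon_prob_space X) (\<sigma> \<circ> r) l sequentially"
        by (rule radon_seq_compact[OF H Y(1,2) bij_betw_imp_inj_on[OF Y(3)]]) blast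
    qed
  qed
  show "aleph0_space (radon_prob_space X)" if a: "aleph0_space X"
  proof (rule aleph0_radon_prob_spaceI[OF H R a assms(2)])
    obtain J :: "'a \<Rightarrow> nat \<Rightarrow> real" where J: "continuous_map X euclidean J" "inj_on J (topspace X)"
      by (rule aleph0_continuous_injection[OF CR H a])
    fix K and \<sigma> :: "nat \<Rightarrow> 'a measure"
    assume "compactin (radon_prob_space X) K" "range \<sigma> \<subseteq> K"
    then show "\<exists>l r. l \<in> K \<and> strict_mono r \<and> limitin (radon_prob_space X) (\<sigma> \<circ> r) l sequentially"
      by (rule radon_seq_compact[OF H metrizable_space_euclidean J]) blast
  qed
qed

end
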